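(* Let $\mathcal{M}=\{1^{m_1},2^{m_2},\ldots,n^{m_n}\}$ be a multiset with all $m_i\ge 1$ and $M=m_1+\cdots+m_n$. Then $$\overline{Q}_{\mathcal{M}}(x,y,z)=\sum_{i=0}^{M-n}z^i\sum_{j=1}^{\lfloor\frac{M+1-i}{2}\rfloor}\gamma_{\mathcal{M},i,j}\,(xy)^j(x+y)^{M+1-i-2j},$$ where $$\gamma_{\mathcal{M},i,j}=\#\{\pi\in\overline{\mathcal{Q}}_{\mathcal{M}}:\mathrm{plat}(\pi)=i,~\mathrm{sd}(\pi)=j,~\mathrm{dsd}(\pi)=0\}.$$ In particular, $\overline{Q}_{\mathcal{M}}(x,y,z)$ is partial $\gamma$-positive, i.e. the coefficient of each power $z^i$ is a polynomial in $x,y$ of the form $\sum_j \gamma_j (xy)^j(x+y)^{N-2j}$ with all $\gamma_j\ge 0$.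
   Context: A quasi-Stirling permutation of $\mathcal{M}$ is a word $\pi=\pi_1\cdots\pi_M$ that is a permutation of the multiset $\mathcal{M}$ (value $i$ appears exactly $m_i$ times) containing no subsequence (not necessarily consecutive) of the form $abab$ with $a\neq b$. Let $\overline{\mathcal{Q}}_{\mathcal{M}}$ be the set of these. Use the convention $\pi_0=\pi_{M+1}=0$. Define $\mathrm{des}(\pi)=\#\{0\le i\le M:\pi_i>\pi_{i+1}\}$, $\mathrm{asc}(\pi)=\#\{0\le i\le M:\pi_i<\pi_{i+1}\}$, $\mathrm{plat}(\pi)=\#\{0\le i\le M:\pi_i=\pi_{i+1}\}$, and $\overline{Q}_{\mathcal{M}}(x,y,z)=\sum_{\pi\in\overline{\mathcal{Q}}_{\mathcal{M}}}x^{\mathrm{des}(\pi)}y^{\mathrm{asc}(\pi)}z^{\mathrm{plat}(\pi)}$. Sibling descents: an index $i$, $1\le i\le M$, is a sibling descent of $\pi$ if (1) $\pi_i$ is the last (rightmost) copy among all entries of $\pi$ with its value, and (2) either $\pi_{i+1}$ is the first (leftmost) copy of its value and $\pi_i>\pi_{i+1}$ (type I), or $\pi_{i+1}$ is a non-first copy of its value (type II). Here $\pi_{M+1}=0$ is regarded as the second copy of the value $0$ (with $\pi_0$ the first copy). An index $i$, $2\le i\le M$, is a double sibling descent if both $i-1$ and $i$ are sibling descents and $i-1$ is of type I. $\mathrm{sd}(\pi)$ and $\mathrm{dsd}(\pi)$ denote the numbers of sibling descents and double sibling descents of $\pi$.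
   Formalization: Double sibling descent is corrected: index i-1 is replaced by the index just before the first copy of the value π_i (the same if π_i occurs once). With i-1 literally, the identity fails for {1,2,2,3}: it gives γ_{1,2}=3 instead of 2. Also n≥1 is made explicit. *)

theory Defs
  imports
    "HOL-Combinatorics.Multiset_Permutations"
    "HOL-Library.Sublist"
    "HOL-Computational_Algebra.Polynomial"
begin

text \<open>The multiset \<open>{1\<^sup>m\<^sup>1, \<dots>, n\<^sup>m\<^sup>n}\<close>.\<close>

definition exp_mset :: "nat \<Rightarrow> (nat \<Rightarrow> nat) \<Rightarrow> nat multiset" where
  "exp_mset n m = (\<Sum>i = 1..n. replicate_mset (m i) i)"

text \<open>\<^const>\<open>subseq\<close> is the relation of being a not necessarily consecutive subsequence.\<close>

definition quasi_stirling :: "nat multiset \<Rightarrow> nat list set" where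
  "quasi_stirling A =
     {\<pi> \<in> permutations_of_multiset A. \<not> (\<exists>a b. a \<noteq> b \<and> subseq [a, b, a, b] \<pi>)}"

text \<open>
  The word \<open>\<pi>\<^sub>0 \<pi>\<^sub>1 \<dots> \<pi>\<^sub>M \<pi>\<^sub>M\<^sub>+\<^sub>1\<close> with \<open>\<pi>\<^sub>0 = \<pi>\<^sub>M\<^sub>+\<^sub>1 = 0\<close>. Its list positions \<open>0, \<dots>, M + 1\<close>
  are the indices used for \<open>\<pi>\<close>, so the letters of \<open>\<pi>\<close> itself are counted from 1.
\<close>

definition padded :: "nat list \<Rightarrow> nat list" where
  "padded \<pi> = 0 # \<pi> @ [0]"

definition des :: "nat list \<Rightarrow> nat" where
  "des \<pi> = card {i. i \<le> length \<pi> \<and> padded \<pi> ! i > padded \<pi> ! (i + 1)}"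

definition asc :: "nat list \<Rightarrow> nat" where
  "asc \<pi> = card {i. i \<le> length \<pi> \<and> padded \<pi> ! i < padded \<pi> ! (i + 1)}"

definition plat :: "nat list \<Rightarrow> nat" where
  "plat \<pi> = card {i. i \<le> length \<pi> \<and> padded \<pi> ! i = padded \<pi> ! (i + 1)}"

definition first_copy :: "nat list \<Rightarrow> nat \<Rightarrow> bool" where
  "first_copy w i \<longleftrightarrow> (\<forall>k < i. w ! k \<noteq> w ! i)"

definition last_copy :: "nat list \<Rightarrow> nat \<Rightarrow> bool" where
  "last_copy w i \<longleftrightarrow> (\<forall>k. i < k \<and> k < length w \<longrightarrow> w ! k \<noteq> w ! i)"

text \<open>
  Copies are looked up in the padded word. For words of positive letters this changes nothing
  at the indices \<open>1, \<dots>, M\<close>, and it makes \<open>\<pi>\<^sub>M\<^sub>+\<^sub>1\<close> the second copy of 0.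
\<close>

definition sibling_descent_I :: "nat list \<Rightarrow> nat \<Rightarrow> bool" where
  "sibling_descent_I \<pi> i \<longleftrightarrow>
     1 \<le> i \<and> i \<le> length \<pi> \<and> last_copy (padded \<pi>) i \<and>
     first_copy (padded \<pi>) (i + 1) \<and> padded \<pi> ! i > padded \<pi> ! (i + 1)"

definition sibling_descent_II :: "nat list \<Rightarrow> nat \<Rightarrow> bool" where
  "sibling_descent_II \<pi> i \<longleftrightarrow>
     1 \<le> i \<and> i \<le> length \<pi> \<and> last_copy (padded \<pi>) i \<and> \<not> first_copy (padded \<pi>) (i + 1)"

definition sibling_descent :: "nat list \<Rightarrow> nat \<Rightarrow> bool" where
  "sibling_descent \<pi> i \<longleftrightarrow> sibling_descent_I \<pi> i \<or> sibling_descent_II \<pi> i"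

text \<open>
  A double sibling descent at \<open>i\<close> consists of two successive descents in the sequence of sibling
  blocks: \<open>i\<close> is a sibling descent, and the index just before the block that ends at \<open>i\<close> is a
  sibling descent of type I. That block starts at the first copy \<open>f\<close> of \<open>\<pi>\<^sub>i\<close>, so the preceding
  index is \<open>f - 1\<close>; it is \<open>i - 1\<close> if \<open>\<pi>\<^sub>i\<close> occurs only once.

  Caution: taking the definition with the position \<open>i - 1\<close> in place of \<open>f - 1\<close> also for repeated
  values, the first of the two descents would never be detected there, and the expansion of the
  quasi-Stirling polynomial would fail. For the multiset \<open>{1, 2, 2, 3}\<close> the coefficient of \<open>z\<close> is
  \<open>x y\<^sup>3 + 4 x\<^sup>2 y\<^sup>2 + x\<^sup>3 y = x y (x + y)\<^sup>2 + 2 (x y)\<^sup>2\<close>, and the words with one plateau, two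
  sibling descents and no double one are 2213 and 3122; with \<open>i - 1\<close> one would also count 1322.
\<close>

definition double_sibling_descent :: "nat list \<Rightarrow> nat \<Rightarrow> bool" where
  "double_sibling_descent \<pi> i \<longleftrightarrow>
     2 \<le> i \<and> i \<le> length \<pi> \<and> sibling_descent \<pi> i \<and>
     (\<exists>f \<le> i. first_copy (padded \<pi>) f \<and> padded \<pi> ! f = padded \<pi> ! i \<and>
        sibling_descent_I \<pi> (f - 1))"

definition sd :: "nat list \<Rightarrow> nat" where
  "sd \<pi> = card {i. sibling_descent \<pi> i}"

definition dsd :: "nat list \<Rightarrow> nat" where
  "dsd \<pi> = card {i. double_sibling_descent \<pi> i}"

text \<open>
  \<open>\<int>[x, y]\<close> is \<^typ>\<open>int poly poly\<close>, with \<open>x\<close> the inner variable, and \<open>\<int>[x, y, z]\<close> is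
  \<^typ>\<open>int poly poly poly\<close>, with \<open>z\<close> the outermost variable. Hence \<open>coeff p i\<close> is the
  coefficient of \<open>z\<^sup>i\<close> in \<open>p\<close>, a polynomial in \<open>x\<close> and \<open>y\<close>.
\<close>

definition x2 :: "int poly poly" where "x2 = [:[:0, 1:]:]"
definition y2 :: "int poly poly" where "y2 = [:0, 1:]"

definition x3 :: "int poly poly poly" where "x3 = [:x2:]"
definition y3 :: "int poly poly poly" where "y3 = [:y2:]"
definition z3 :: "int poly poly poly" where "z3 = [:0, 1:]"

definition quasi_stirling_poly :: "nat multiset \<Rightarrow> int poly poly poly" where
  "quasi_stirling_poly A = (\<Sum>\<pi> \<in> quasi_stirling A. x3 ^ des \<pi> * y3 ^ asc \<pi> * z3 ^ plat \<pi>)"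

definition gamma_coeff :: "nat multiset \<Rightarrow> nat \<Rightarrow> nat \<Rightarrow> nat" where
  "gamma_coeff A i j = card {\<pi> \<in> quasi_stirling A. plat \<pi> = i \<and> sd \<pi> = j \<and> dsd \<pi> = 0}"

definition gamma_positive :: "int poly poly \<Rightarrow> bool" where
  "gamma_positive p \<longleftrightarrow>
     (\<exists>N (\<gamma> :: nat \<Rightarrow> int). (\<forall>j. \<gamma> j \<ge> 0) \<and>
        p = (\<Sum>j = 0..N div 2. of_int (\<gamma> j) * (x2 * y2) ^ j * (x2 + y2) ^ (N - 2 * j)))"

definition partial_gamma_positive :: "int poly poly poly \<Rightarrow> bool" where
  "partial_gamma_positive p \<longleftrightarrow> (\<forall>i. gamma_positive (coeff p i))"

end

theory Submission
  imports Defs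
begin

text \<open>
  A quasi-Stirling word is a depth-first traversal of a plane tree: between two consecutive copies
  of a letter \<open>b\<close> (a gap of \<open>b\<close>) the word is a sequence of blocks, each reaching from the first to
  the last copy of some letter, and every adjacent pair of the padded word belongs to exactly one
  gap. Descents, ascents, plateaus and sibling descents are therefore additive over the gaps, and
  both sides are sums over words of products over gaps. The interior of the blocks does not depend
  on their order within a gap, so it is enough to compare, for every gap, the sums over all orders
  of its blocks. For a gap of \<open>b\<close> with blocks \<open>c\<^sub>1, \<dots>, c\<^sub>k\<close> the left-hand side counts cyclic descents
  of \<open>b, c\<^sub>1, \<dots>, c\<^sub>k\<close>. These are unchanged by a cyclic shift of the values, so \<open>b\<close> may be assumed
  to be the minimum, and the claim becomes the gamma expansion of the Eulerian polynomials, which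
  follows by splitting a permutation at its minimum.
\<close>

section \<open>Gaps of a word\<close>

text \<open>Trees are not formalized: a word is cut at the next copy of its first letter, and the
  tree survives only in \<open>tops\<close> and \<open>gaps\<close>. The obstacle is that the gaps
  are not independent, because reordering the blocks of one gap carries along whole subwords with
  gaps of their own. The exchange of weights is therefore done on sums instead of by a bijection.
  For a fixed list of outermost labels, the sum over words arises by applying one operator per label
  to functions of letter sets. These operators are convolutions over subsets and commute, so the
  order of the labels is irrelevant, and induction on the letter set exchanges the weight in all
  gaps at once. Sibling descents, in contrast, are defined by positions. They are carried over to
  gaps by their letters: a sibling descent sits at a last copy, so its letter identifies it, and in
  a noncrossing word every letter labels exactly one block. The weights live in an arbitrary
  commutative semiring, so the comparisons use no cancellation.\<close>

definition noncrossing :: "'a list \<Rightarrow> bool" where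
  "noncrossing w \<longleftrightarrow> \<not> (\<exists>a b. a \<noteq> b \<and> subseq [a, b, a, b] w)"

lemma noncrossing_Nil [simp]: "noncrossing []"
  by (simp add: noncrossing_def)

lemma noncrossing_subseq: "noncrossing w \<Longrightarrow> subseq v w \<Longrightarrow> noncrossing v"
  unfolding noncrossing_def by (meson subseq_order.order_trans)

lemma subseq_set: "subseq xs ys \<Longrightarrow> set xs \<subseteq> set ys"
  by (induction rule: list_emb.induct) auto

text \<open>An occurrence of the pattern that uses the new first letter needs a second copy of
  it.\<close>

lemma noncrossing_Cons_notin: "b \<notin> set v \<Longrightarrow> noncrossing (b # v) \<longleftrightarrow> noncrossing v"
proof
  assume "b \<notin> set v" "noncrossing v"
  show "noncrossing (b # v)"
    unfolding noncrossing_def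
  proof safe
    fix a c assume "a \<noteq> c" and s: "subseq [a, c, a, c] (b # v)"
    have "b \<noteq> a"
    proof
      assume "b = a"
      then have "subseq [c, a, c] v" using s by (simp only: subseq_Cons2_iff if_True)
      from subseq_set[OF this] show False using \<open>b = a\<close> \<open>b \<notin> set v\<close> by simp
    qed
    then have "subseq [a, c, a, c] v" using s by (metis subseq_Cons2_neq)
    then show False using \<open>noncrossing v\<close> \<open>a \<noteq> c\<close> unfolding noncrossing_def by blast
  qed
next
  show "noncrossing v" if "noncrossing (b # v)"
    using that by (rule noncrossing_subseq) (intro list_emb_Cons subseq_order.order_refl)
qed

text \<open>This is the recursion of the plane tree. A letter on both sides of the second
  \<open>b\<close> would give the pattern together with the two copies of \<open>b\<close>.
  Conversely, an occurrence of the pattern is cut at the second \<open>b\<close>; only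
  \<open>b\<close> itself can appear in both pieces, which refutes each of the five ways to
  cut.\<close>

lemma noncrossing_split:
  assumes "b \<notin> set u"
  shows "noncrossing (b # u @ b # v) \<longleftrightarrow>
    noncrossing u \<and> noncrossing (b # v) \<and> set u \<inter> set v = {}"
proof
  assume nc: "noncrossing (b # u @ b # v)"
  have False if "c \<in> set u" "c \<in> set v" for c
  proof -
    have "subseq ([b] @ [c] @ [b] @ [c]) ([b] @ u @ [b] @ v)"
      using that by (intro list_emb_append_mono) (auto simp: subseq_singleton_left)
    then have "subseq [b, c, b, c] (b # u @ b # v)" by simp
    moreover have "b \<noteq> c" using that assms by blast
    ultimately show False using nc unfolding noncrossing_def by blast
  qed
  moreover have "subseq u (b # u @ b # v)"
    by (intro list_emb_Cons list_emb_prefix) simp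
  moreover have "subseq (b # v) (b # u @ b # v)"
    using list_emb_append2[of "(=)" "b # v" "b # v" "b # u"] by simp
  ultimately show "noncrossing u \<and> noncrossing (b # v) \<and> set u \<inter> set v = {}"
    using nc noncrossing_subseq by blast
next
  assume R: "noncrossing u \<and> noncrossing (b # v) \<and> set u \<inter> set v = {}"
  have nc: "noncrossing (b # u)" using R assms by (simp add: noncrossing_Cons_notin)
  show "noncrossing (b # u @ b # v)"
    unfolding noncrossing_def
  proof safe
    fix a c assume ac: "a \<noteq> c" and s: "subseq [a, c, a, c] (b # u @ b # v)"
    from s have "subseq [a, c, a, c] ((b # u) @ (b # v))" by simp
    then obtain xs ys where xy: "[a, c, a, c] = xs @ ys" "subseq xs (b # u)" "subseq ys (b # v)"
      by (rule subseq_appendE)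
    have both: "p = b" if "p \<in> set xs" "p \<in> set ys" for p
      using that subseq_set[OF xy(2)] subseq_set[OF xy(3)] R by auto
    have "length xs + length ys = 4" using arg_cong[OF xy(1), of length] by simp
    then consider "xs = []" | "ys = []" | "xs = [a]" "ys = [c, a, c]" |
       "xs = [a, c]" "ys = [a, c]" | "xs = [a, c, a]" "ys = [c]"
      using xy(1) by (auto simp: Cons_eq_append_conv)
    then show False
    proof cases
      case 1
      then have "subseq [a, c, a, c] (b # v)" using xy by (simp only: append_Nil)
      then show ?thesis using R ac unfolding noncrossing_def by blast
    next
      case 2
      then have "subseq [a, c, a, c] (b # u)" using xy by (simp only: append_Nil2)
      then show ?thesis using nc ac unfolding noncrossing_def by blast
    next
      case 3
      then have "a = b" using both by auto
      then have "subseq [c, a, c] v" using xy 3 ac by auto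
      then have "subseq [a, c, a, c] (b # v)" using \<open>a = b\<close> by auto
      then show ?thesis using R ac unfolding noncrossing_def by blast
    next
      case 4 then show ?thesis using both ac by auto
    next
      case 5
      then have "c = b" using both by auto
      then have "subseq [a, c, a] u" using xy 5 ac by auto
      then show ?thesis using \<open>c = b\<close> assms subseq_set by fastforce
    qed
  qed
qed

text \<open>
  \<open>tops w\<close> lists the labels of the outermost blocks of \<open>w\<close>. The list \<open>gaps w\<close> has an entry for every
  pair of consecutive copies of a letter: the letter and the labels of the blocks between the copies.
\<close>

function tops :: "'a list \<Rightarrow> 'a list" where
  "tops [] = []"
| "tops (b # v) = (if b \<in> set v then tops (dropWhile (\<lambda>c. c \<noteq> b) v) else b # tops v)"
  by pat_completeness auto
termination
  by (relation "measure length") (auto simp: le_imp_less_Suc length_dropWhile_le)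

function gaps :: "'a list \<Rightarrow> ('a \<times> 'a list) list" where
  "gaps [] = []"
| "gaps (b # v) =
    (if b \<in> set v
     then (b, tops (takeWhile (\<lambda>c. c \<noteq> b) v)) # gaps (takeWhile (\<lambda>c. c \<noteq> b) v) @
          gaps (dropWhile (\<lambda>c. c \<noteq> b) v)
     else gaps v)"
  by pat_completeness auto
termination
  by (relation "measure length")
    (auto simp: le_imp_less_Suc length_dropWhile_le length_takeWhile_le)

lemmas [simp del] = tops.simps(2) gaps.simps(2)

lemma takeWhile_neq_append: "b \<notin> set u \<Longrightarrow> takeWhile (\<lambda>c. c \<noteq> b) (u @ b # v) = u"
  by (subst takeWhile_append2) auto

lemma dropWhile_neq_append: "b \<notin> set u \<Longrightarrow> dropWhile (\<lambda>c. c \<noteq> b) (u @ b # v) = b # v"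
  by (subst dropWhile_append2) auto

lemma append_Cons_eq_imp:
  assumes "b \<notin> set u" "b \<notin> set u'" "u @ b # v = u' @ b # v'"
  shows "u = u' \<and> v = v'"
proof -
  have "takeWhile (\<lambda>c. c \<noteq> b) (u @ b # v) = takeWhile (\<lambda>c. c \<noteq> b) (u' @ b # v')"
    using assms(3) by (rule arg_cong)
  then have "u = u'" unfolding takeWhile_neq_append[OF assms(1)] takeWhile_neq_append[OF assms(2)] .
  then show ?thesis using assms(3) by simp
qed

lemma tops_Cons [simp]: "b \<notin> set v \<Longrightarrow> tops (b # v) = b # tops v"
  by (simp add: tops.simps)

lemma gaps_Cons [simp]: "b \<notin> set v \<Longrightarrow> gaps (b # v) = gaps v"
  by (simp add: gaps.simps)

lemma tops_split [simp]: "b \<notin> set u \<Longrightarrow> tops (b # u @ b # v) = tops (b # v)"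
  by (subst tops.simps) (simp add: dropWhile_neq_append)

lemma gaps_split [simp]:
  "b \<notin> set u \<Longrightarrow> gaps (b # u @ b # v) = (b, tops u) # gaps u @ gaps (b # v)"
  by (subst gaps.simps) (simp add: dropWhile_neq_append takeWhile_neq_append)

text \<open>Mirrors the recursion of \<open>tops\<close> and \<open>gaps\<close>. In the third case
  the block of \<open>b\<close> may still be open after \<open>u\<close>, so the remainder keeps its
  letter in front: it is \<open>b # v\<close> and not \<open>v\<close>.\<close>

lemma block_induct [case_names Nil Cons split]:
  assumes "P []"
    and "\<And>b v. b \<notin> set v \<Longrightarrow> P v \<Longrightarrow> P (b # v)"
    and "\<And>b u v. b \<notin> set u \<Longrightarrow> P u \<Longrightarrow> P (b # v) \<Longrightarrow> P (b # u @ b # v)"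
  shows "P w"
proof (induction w rule: length_induct)
  case (1 w)
  show ?case
  proof (cases w)
    case Nil then show ?thesis using assms(1) by simp
  next
    case (Cons b v)
    show ?thesis
    proof (cases "b \<in> set v")
      case False then show ?thesis using assms(2) 1 Cons by auto
    next
      case True
      then obtain u v' where "v = u @ b # v'" "b \<notin> set u" by (meson split_list_first)
      then show ?thesis using assms(3)[of b u v'] 1 Cons by auto
    qed
  qed
qed

text \<open>The padding turns the outermost blocks into one more gap, so the root of the tree needs
  no separate treatment.\<close>

lemma gaps_padded: "a \<notin> set w \<Longrightarrow> gaps (a # w @ [a]) = (a, tops w) # gaps w"
  by simp

lemma tops_eq_Nil_iff [simp]: "tops w = [] \<longleftrightarrow> w = []"
  by (induction w rule: block_induct) auto

text \<open>A block begins and ends with its own label.\<close>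

lemma hd_tops: "w \<noteq> [] \<Longrightarrow> hd (tops w) = hd w"
  by (induction w rule: block_induct) auto

lemma last_tops: "w \<noteq> [] \<Longrightarrow> last (tops w) = last w"
  by (induction w rule: block_induct) auto

text \<open>Every position either contributes the label of a block or is accounted for by one gap
  between consecutive copies, which is the \<open>Suc\<close>.\<close>

lemma length_eq_gaps:
  "length w = length (tops w) + (\<Sum>(b, cs) \<leftarrow> gaps w. Suc (length cs))"
  by (induction w rule: block_induct) auto

text \<open>Every letter labels exactly one block: the two halves of a split have disjoint letters
  by \<open>noncrossing_split\<close>, so no label is listed twice.\<close>

lemma labels_gaps:
  "noncrossing w \<Longrightarrow> distinct (tops w @ concat (map snd (gaps w))) \<and>
     set (tops w @ concat (map snd (gaps w))) = set w"
proof (induction w rule: block_induct)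
  case Nil then show ?case by simp
next
  case (Cons b v) then show ?case by (auto simp: noncrossing_Cons_notin)
next
  case (split b u v)
  then have nc: "noncrossing u" "noncrossing (b # v)" and "set u \<inter> set v = {}"
    by (simp_all add: noncrossing_split)
  then have disj: "set u \<inter> set (b # v) = {}" using split.hyps by auto
  define A where "A = tops u @ concat (map snd (gaps u))"
  define B C where "B = tops (b # v)" and "C = concat (map snd (gaps (b # v)))"
  have "distinct A \<and> set A = set u" "distinct (B @ C) \<and> set (B @ C) = set (b # v)"
    unfolding A_def B_def C_def using split.IH nc by blast+
  then have "distinct (A @ B @ C) \<and> set (A @ B @ C) = set u \<union> set (b # v)"
    using disj by (simp only: distinct_append[of A] set_append[of A])
  \<comment> \<open>The two lists differ only in the order of their pieces, and both claims depend
    only on the multiset.\<close>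
  moreover have "mset (tops (b # u @ b # v) @ concat (map snd (gaps (b # u @ b # v)))) =
      mset (A @ B @ C)"
    using split.hyps by (simp add: A_def B_def C_def)
  ultimately have "distinct (tops (b # u @ b # v) @ concat (map snd (gaps (b # u @ b # v)))) \<and>
      set (tops (b # u @ b # v) @ concat (map snd (gaps (b # u @ b # v)))) = set u \<union> set (b # v)"
    by (metis mset_eq_imp_distinct_iff mset_eq_setD)
  then show ?case by (simp only:) auto
qed

lemma gaps_parent_notin: "noncrossing w \<Longrightarrow> (b, cs) \<in> set (gaps w) \<Longrightarrow> b \<notin> set cs"
proof (induction w rule: block_induct)
  case (split c u v)
  then have nc: "noncrossing u" "noncrossing (c # v)" by (simp_all add: noncrossing_split)
  then have "c \<notin> set (tops u)" using split.hyps labels_gaps[of u] by auto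
  then show ?case using split.IH(1)[OF nc(1)] split.IH(2)[OF nc(2)] split.prems split.hyps by auto
qed (auto simp: noncrossing_Cons_notin)

section \<open>Adjacent letters of a word and of its gaps\<close>

definition pairs :: "'a list \<Rightarrow> ('a \<times> 'a) list" where
  "pairs w = zip w (tl w)"

lemma pairs_simps [simp]:
  "pairs [] = []" "pairs [a] = []" "pairs (a # b # w) = (a, b) # pairs (b # w)"
  by (auto simp: pairs_def)

lemma pairs_append: "pairs (u @ b # v) = pairs (u @ [b]) @ pairs (b # v)"
proof (induction u)
  case (Cons a u) then show ?case by (cases u) auto
qed simp

lemma pairs_append_Cons: "pairs (a # u @ b # v) = pairs (a # u @ [b]) @ pairs (b # v)"
  using pairs_append[of "a # u" b v] by simp

text \<open>Contracting every block to its label loses exactly the adjacent pairs inside the blocks,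
  and those are collected by the gaps. The end letters are arbitrary because the induction uses
  \<open>u\<close> between two copies of \<open>b\<close>, and the remainder between
  \<open>a\<close> and \<open>c\<close>.\<close>

lemma mset_pairs_gaps:
  "mset (pairs (a # w @ [c])) =
     mset (pairs (a # tops w @ [c]) @ concat (map (\<lambda>(b, cs). pairs (b # cs @ [b])) (gaps w)))"
proof (induction w arbitrary: a c rule: block_induct)
  case (split b u v)
  have "pairs (a # (b # u @ b # v) @ [c]) = (a, b) # pairs (b # u @ [b]) @ pairs (b # v @ [c])"
    using pairs_append_Cons[of b u b "v @ [c]"] by simp
  then show ?case using split.IH(1)[of b b] split.IH(2)[of a c] split.hyps by simp
qed auto

section \<open>Gamma expansion of cyclic descents\<close>

lemma sum_permutations_of_set_split:
  fixes f :: "'a list \<Rightarrow> 'b::comm_monoid_add"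
  assumes "finite A" "a \<notin> A"
  shows "(\<Sum>w\<in>permutations_of_set (insert a A). f w) =
    (\<Sum>B\<in>Pow A. \<Sum>u\<in>permutations_of_set B. \<Sum>v\<in>permutations_of_set (A - B). f (u @ a # v))"
proof -
  define T where "T = (SIGMA B:Pow A. permutations_of_set B \<times> permutations_of_set (A - B))"
  define h where "h = (\<lambda>(B :: 'a set, u, v). u @ a # v)"
  have "inj_on h T"
  proof (rule inj_onI)
    fix p p' assume *: "p \<in> T" "p' \<in> T" "h p = h p'"
    obtain B u v B' u' v' where p: "p = (B, u, v)" "p' = (B', u', v')"
      by (metis prod_cases3)
    then have B: "B = set u" "B' = set u'" "B \<subseteq> A" "B' \<subseteq> A"
      using * by (auto simp: T_def dest: permutations_of_setD)
    then have "a \<notin> set u" "a \<notin> set u'" using assms by auto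
    moreover have "u @ a # v = u' @ a # v'" using * p by (simp add: h_def)
    ultimately have "u = u' \<and> v = v'" by (rule append_Cons_eq_imp)
    then show "p = p'" using B p by simp
  qed
  moreover have "permutations_of_set (insert a A) = h ` T"
  proof (intro equalityI subsetI)
    fix w assume "w \<in> permutations_of_set (insert a A)"
    then have w: "set w = insert a A" "distinct w" by (auto dest: permutations_of_setD)
    then obtain u v where uv: "w = u @ a # v" by (metis insertI1 split_list)
    have "(set u, u, v) \<in> T"
      unfolding T_def using w assms uv by (auto simp: permutations_of_set_def)
    then show "w \<in> h ` T" using uv by (force simp: h_def)
  next
    fix w assume "w \<in> h ` T"
    then show "w \<in> permutations_of_set (insert a A)"
      using assms by (auto simp: permutations_of_set_def h_def T_def)
  qed
  ultimately have "(\<Sum>w\<in>permutations_of_set (insert a A). f w) = (\<Sum>p\<in>T. f (h p))"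
    by (simp add: sum.reindex)
  also have "\<dots> = (\<Sum>B\<in>Pow A. \<Sum>(u, v)\<in>permutations_of_set B \<times> permutations_of_set (A - B).
      f (u @ a # v))"
    using assms unfolding T_def by (subst sum.Sigma) (auto simp: h_def intro!: sum.cong)
  finally show ?thesis by (simp add: sum.cartesian_product)
qed

section \<open>Weights of cyclic sequences and their gamma counterpart\<close>

definition step_weight :: "'r \<Rightarrow> 'r \<Rightarrow> 'r \<Rightarrow> nat \<Rightarrow> nat \<Rightarrow> 'r" where
  "step_weight x y z p q = (if p > q then x else if p < q then y else z)"

definition path_weight :: "'r::comm_monoid_mult \<Rightarrow> 'r \<Rightarrow> 'r \<Rightarrow> nat list \<Rightarrow> 'r" where
  "path_weight x y z w = (\<Prod>(p, q) \<leftarrow> pairs w. step_weight x y z p q)"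

lemma path_weight_simps [simp]:
  "path_weight x y z [a] = 1"
  "path_weight x y z (a # b # w) = step_weight x y z a b * path_weight x y z (b # w)"
  by (simp_all add: path_weight_def)

lemma path_weight_append:
  "path_weight x y z (u @ a # v) = path_weight x y z (u @ [a]) * path_weight x y z (a # v)"
  unfolding path_weight_def by (subst pairs_append) simp

text \<open>A recursive form of the gamma monomial, as \<open>gamma_weight_eq\<close> shows. The end
  of the list counts as a descent. A leading ascent contributes \<open>x + y\<close>; a leading
  descent must be followed by an ascent, and the two together contribute \<open>x * y\<close>; two
  successive descents give 0.\<close>

fun gamma_weight :: "'r::comm_semiring_1 \<Rightarrow> 'r \<Rightarrow> nat list \<Rightarrow> 'r" where
  "gamma_weight x y [] = 1"
| "gamma_weight x y [a] = x * y"
| "gamma_weight x y [a, b] = (if a < b then (x + y) * (x * y) else 0)"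
| "gamma_weight x y (a # b # c # w) =
    (if a < b then (x + y) * gamma_weight x y (b # c # w)
     else if b < c then x * y * gamma_weight x y (c # w) else 0)"

lemma gamma_weight_Cons_less:
  "v \<noteq> [] \<Longrightarrow> m < hd v \<Longrightarrow> gamma_weight x y (m # v) = (x + y) * gamma_weight x y v"
  by (cases "(x, y, m # v)" rule: gamma_weight.cases) auto

text \<open>The descent from the last entry of \<open>u\<close> to the minimum \<open>m\<close>
  plays the role of the descent at the end of \<open>u\<close> alone. It is followed by an ascent if
  \<open>v\<close> is nonempty; otherwise the end after \<open>m\<close> makes it a double
  descent.\<close>

lemma gamma_weight_split:
  assumes "u \<noteq> []" "\<forall>a\<in>set u. m < a" "\<forall>a\<in>set v. m < a"
  shows "gamma_weight x y (u @ m # v) =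
    (if v = [] then 0 else gamma_weight x y u * gamma_weight x y v)"
  using assms
proof (induction x y u rule: gamma_weight.induct)
  case (2 x y a) then show ?case by (cases v) auto
next
  case (3 x y a b)
  then have "gamma_weight x y (b # m # v) = (if v = [] then 0 else x * y * gamma_weight x y v)"
    by (cases v) auto
  then show ?case using 3 by (auto simp: algebra_simps)
next
  case (4 x y a b c w) then show ?case by (auto simp: algebra_simps)
qed auto

text \<open>Seen from letters above \<open>m\<close>, a step to or from \<open>m\<close> compares
  like a step to or from 0. Only an empty side leaves a step between 0 and \<open>m\<close>.\<close>

lemma path_weight_split:
  assumes "\<forall>a\<in>set u. m < a" "\<forall>a\<in>set v. m < a" "0 < m"
  shows "path_weight x y z (0 # (u @ m # v) @ [0]) =
    (if u = [] then y else path_weight x y z (0 # u @ [0])) *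
    (if v = [] then x else path_weight x y z (0 # v @ [0]))"
proof -
  have u: "path_weight x y z (0 # u @ [m]) =
      (if u = [] then y else path_weight x y z (0 # u @ [0]))"
  proof (cases "u = []")
    case False
    then obtain u' a where u: "u = u' @ [a]" using rev_exhaust by blast
    then have "step_weight x y z a m = step_weight x y z a 0"
      using assms by (simp add: step_weight_def)
    then show ?thesis
      using u path_weight_append[of x y z "0 # u'" a "[m]"]
        path_weight_append[of x y z "0 # u'" a "[0]"] by simp
  qed (use assms in \<open>simp add: step_weight_def\<close>)
  have v: "path_weight x y z (m # v @ [0]) =
      (if v = [] then x else path_weight x y z (0 # v @ [0]))"
  proof (cases v)
    case (Cons b v')
    then have "step_weight x y z m b = step_weight x y z 0 b"
      using assms by (simp add: step_weight_def)
    then show ?thesis using Cons by simp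
  qed (use assms in \<open>simp add: step_weight_def\<close>)
  have "path_weight x y z (0 # (u @ m # v) @ [0]) =
      path_weight x y z (0 # u @ [m]) * path_weight x y z (m # v @ [0])"
    using path_weight_append[of x y z "0 # u" m "v @ [0]"] by simp
  then show ?thesis unfolding u v .
qed

text \<open>
  Splitting a permutation at its minimum gives both sides the same recursion: if only one of the
  two parts is empty, the factors \<open>x\<close> and \<open>y\<close> of the two cases on the left correspond to the
  factors \<open>0\<close> and \<open>x + y\<close> on the right.
\<close>

lemma sum_path_weight_eq_sum_gamma_weight:
  fixes x y z :: "'r::comm_semiring_1"
  assumes "finite A" "finite B" "card A = card B" "A \<noteq> {}" "0 \<notin> A"
  shows "(\<Sum>w\<in>permutations_of_set A. path_weight x y z (0 # w @ [0])) =
    (\<Sum>w\<in>permutations_of_set B. gamma_weight x y w)"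
  using assms
\<comment> \<open>\<open>A\<close> and \<open>B\<close> are unrelated sets of the same size, as only
  the number of letters matters on either side. The induction can thus match subsets by size alone,
  and the cyclic shift can later be applied to the left side only.\<close>
proof (induction "card A" arbitrary: A B rule: less_induct)
  case less
  define L where "L A = (\<Sum>w\<in>permutations_of_set A. path_weight x y z (0 # w @ [0]))" for A
  define R where "R A = (\<Sum>w\<in>permutations_of_set A. gamma_weight x y w)" for A
  define m n A' B' where "m = Min A" and "n = Min B" and "A' = A - {m}" and "B' = B - {n}"
  have "B \<noteq> {}" using less.prems by auto
  have A: "A = insert m A'" "finite A'" "\<And>a. a \<in> A' \<Longrightarrow> m < a"
    using less.prems Min_le[of A] Min_in[of A] unfolding A'_def m_def
    by (auto simp: insert_absorb order.strict_iff_order)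
  then have "m > 0" using less.prems by (cases m) auto
  have B: "B = insert n B'" "finite B'" "\<And>b. b \<in> B' \<Longrightarrow> n < b"
    using less.prems \<open>B \<noteq> {}\<close> Min_le[of B] Min_in[of B] unfolding B'_def n_def
    by (auto simp: insert_absorb order.strict_iff_order)
  have m: "m \<notin> A'" "n \<notin> B'" by (auto simp: A'_def B'_def)
  have card: "card A' = card B'" "card A = Suc (card A')"
    using less.prems(3) card_insert_disjoint[OF A(2) m(1)] card_insert_disjoint[OF B(2) m(2)]
    unfolding A(1)[symmetric] B(1)[symmetric] by simp_all
  have IH: "L S = R T" if "S \<subseteq> A'" "T \<subseteq> B'" "S \<noteq> {}" "card S = card T" for S T
    unfolding L_def R_def
  proof (rule less.hyps)
    show "card S < card A" using card A that card_mono[of A' S] by auto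
    show "finite S" "finite T" using that A B by (auto intro: finite_subset)
    show "0 \<notin> S" using that A(1) less.prems by auto
  qed (use that in auto)
  define l where "l S = (\<Sum>u\<in>permutations_of_set S. \<Sum>v\<in>permutations_of_set (A' - S).
      path_weight x y z (0 # (u @ m # v) @ [0]))" for S
  define r where "r S = (\<Sum>u\<in>permutations_of_set S. \<Sum>v\<in>permutations_of_set (B' - S).
      gamma_weight x y (u @ n # v))" for S
  have LA: "L A = (\<Sum>S\<in>Pow A'. l S)"
    unfolding L_def l_def A(1) by (rule sum_permutations_of_set_split[OF A(2) m(1)])
  have RB: "R B = (\<Sum>S\<in>Pow B'. r S)"
    unfolding R_def r_def B(1) by (rule sum_permutations_of_set_split[OF B(2) m(2)])
  have l: "l S = (if S = {} then y else L S) * (if S = A' then x else L (A' - S))"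
    if "S \<subseteq> A'" for S
  proof -
    have "l S = (\<Sum>u\<in>permutations_of_set S. \<Sum>v\<in>permutations_of_set (A' - S).
      (if S = {} then y else path_weight x y z (0 # u @ [0])) *
      (if S = A' then x else path_weight x y z (0 # v @ [0])))"
      unfolding l_def
    proof (intro sum.cong refl)
      fix u v assume "u \<in> permutations_of_set S" "v \<in> permutations_of_set (A' - S)"
      then have uv: "set u = S" "set v = A' - S" by (auto dest: permutations_of_setD)
      have e: "u = [] \<longleftrightarrow> S = {}" "v = [] \<longleftrightarrow> S = A'" using uv that
        by (metis set_empty, metis Diff_eq_empty_iff set_empty subset_antisym)
      show "path_weight x y z (0 # (u @ m # v) @ [0]) =
        (if S = {} then y else path_weight x y z (0 # u @ [0])) *
        (if S = A' then x else path_weight x y z (0 # v @ [0]))"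
        using uv that A \<open>m > 0\<close> by (subst path_weight_split) (auto simp: e)
    qed
    also have "\<dots> = (\<Sum>u\<in>permutations_of_set S. if S = {} then y else path_weight x y z (0 # u @ [0]))
      * (\<Sum>v\<in>permutations_of_set (A' - S). if S = A' then x else path_weight x y z (0 # v @ [0]))"
      by (simp add: sum_product)
    finally show ?thesis by (auto simp: L_def)
  qed
  have r: "r S = (if S = {} then (if B' = {} then x * y else (x + y) * R B')
      else if S = B' then 0 else R S * R (B' - S))" if "S \<subseteq> B'" for S
  proof -
    have "r S = (\<Sum>u\<in>permutations_of_set S. \<Sum>v\<in>permutations_of_set (B' - S).
      if S = {} then (if B' = {} then x * y else (x + y) * gamma_weight x y v)
      else if S = B' then 0 else gamma_weight x y u * gamma_weight x y v)"
      unfolding r_def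
    proof (intro sum.cong refl)
      fix u v assume "u \<in> permutations_of_set S" "v \<in> permutations_of_set (B' - S)"
      then have uv: "set u = S" "set v = B' - S" by (auto dest: permutations_of_setD)
      have e: "u = [] \<longleftrightarrow> S = {}" "v = [] \<longleftrightarrow> S = B'" using uv that
        by (metis set_empty, metis Diff_eq_empty_iff set_empty subset_antisym)
      have "v \<noteq> [] \<Longrightarrow> n < hd v" using uv B(3) hd_in_set[of v] by blast
      moreover have "\<forall>a\<in>set u. n < a" "\<forall>a\<in>set v. n < a" using uv that B by auto
      ultimately show "gamma_weight x y (u @ n # v) =
        (if S = {} then (if B' = {} then x * y else (x + y) * gamma_weight x y v)
        else if S = B' then 0 else gamma_weight x y u * gamma_weight x y v)"
        using e by (cases "u = []") (auto simp: gamma_weight_split gamma_weight_Cons_less)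
    qed
    also have "\<dots> = (if S = {} then (if B' = {} then x * y else (x + y) * R B')
      else if S = B' then 0 else R S * R (B' - S))"
    proof -
      consider "S = {}" | "S \<noteq> {}" "S = B'" | "S \<noteq> {}" "S \<noteq> B'" by blast
      then show ?thesis
      proof cases
        case 1 then show ?thesis by (simp add: R_def sum_distrib_left)
      next
        case 2 then show ?thesis by simp
      next
        case 3 then show ?thesis by (simp only: R_def sum_product if_False)
      qed
    qed
    finally show ?thesis .
  qed
  show ?case
  proof (cases "A' = {}")
    case True
    then have "B' = {}" using card B by simp
    then show ?thesis using LA RB l r True by (simp add: L_def R_def mult.commute)
  next
    case False
    then have "B' \<noteq> {}" using card A by auto
    \<comment> \<open>Any bijection will do, monotone or not: for a proper nonempty subset both
      factors are covered by \<open>IH\<close>, which compares only cardinalities.\<close>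
    obtain f where f: "bij_betw f A' B'" using finite_same_card_bij A B card by blast
    have P: "Pow C = insert {} (insert C (Pow C - {{}, C}))" for C :: "nat set"
      using Diff_partition[of "{{}, C}" "Pow C"]
      by (simp only: Un_insert_left Un_empty_left) simp
    have "L A = l {} + l A' + (\<Sum>S\<in>Pow A' - {{}, A'}. l S)"
      unfolding LA by (subst P) (use A False in \<open>simp add: add.assoc\<close>)
    also have "l {} + l A' = (x + y) * L A'"
      using l[of "{}"] l[of A'] False by (simp add: algebra_simps)
    also have "L A' = R B'" using IH[of A' B'] False card by simp
    also have "(\<Sum>S\<in>Pow A' - {{}, A'}. l S) = (\<Sum>S\<in>Pow B' - {{}, B'}. r S)"
    proof (rule sum.reindex_bij_betw[of "image f" "Pow A' - {{}, A'}" "Pow B' - {{}, B'}" r,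
          THEN trans[rotated]])
      have b: "inj_on (image f) (Pow A')" "image f ` Pow A' = Pow B'"
        using bij_betw_Pow[OF f] by (simp_all only: bij_betw_def)
      have "image f ` (Pow A' - {{}, A'}) = image f ` Pow A' - image f ` {{}, A'}"
        by (rule inj_on_image_set_diff[OF b(1)]) auto
      then show "bij_betw (image f) (Pow A' - {{}, A'}) (Pow B' - {{}, B'})"
        using f b inj_on_subset[OF b(1), of "Pow A' - {{}, A'}"] by (simp add: bij_betw_def)
      show "(\<Sum>S\<in>Pow A' - {{}, A'}. l S) = (\<Sum>S\<in>Pow A' - {{}, A'}. r (f ` S))"
      proof (intro sum.cong refl)
        fix S assume S: "S \<in> Pow A' - {{}, A'}"
        have inj: "inj_on f A'" and im: "f ` A' = B'" using f by (auto simp: bij_betw_def)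
        have "f ` S \<noteq> B'" using S inj im by (metis Diff_iff Pow_iff inj_on_image_eq_iff insertCI order_refl)
        moreover have "L S = R (f ` S)"
          using S im inj by (intro IH) (auto simp: card_image inj_on_subset)
        moreover have "L (A' - S) = R (f ` (A' - S))"
          using S im inj by (intro IH) (auto simp: card_image inj_on_subset)
        moreover have "f ` (A' - S) = B' - f ` S"
          using S im inj by (simp add: inj_on_image_set_diff)
        moreover have "f ` S \<subseteq> B'" "f ` S \<noteq> {}" using S im by auto
        ultimately show "l S = r (f ` S)" using S l[of S] r[of "f ` S"] by simp
      qed
    qed
    also have "(x + y) * R B' + (\<Sum>S\<in>Pow B' - {{}, B'}. r S) = R B"
    proof -
      have "R B = r {} + r B' + (\<Sum>S\<in>Pow B' - {{}, B'}. r S)"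
        unfolding RB by (subst P) (use B \<open>B' \<noteq> {}\<close> in \<open>simp add: add.assoc\<close>)
      moreover have "r {} = (x + y) * R B'" "r B' = 0"
        using r[of "{}"] r[of B'] \<open>B' \<noteq> {}\<close> by simp_all
      ultimately show ?thesis by simp
    qed
    finally show ?thesis by (simp add: L_def R_def)
  qed
qed

text \<open>Subtraction of \<open>a\<close> modulo \<open>N\<close> on values below
  \<open>N\<close>.\<close>

definition rotate_below :: "nat \<Rightarrow> nat \<Rightarrow> nat \<Rightarrow> nat" where
  "rotate_below N a v = (if v < a then v + N - a else v - a)"

text \<open>The shift keeps the order within the values below \<open>a\<close> and within the
  others, and reverses it between the two classes. A path from \<open>p >= a\<close> to
  \<open>a\<close> changes class equally often in both directions, so the swaps of \<open>x\<close>
  and \<open>y\<close> cancel out. For \<open>p < a\<close> one upward change is left over, which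
  weighs \<open>y\<close> before and \<open>x\<close> after the shift; multiplying crosswise
  expresses this without division.\<close>

lemma path_weight_rotate_below:
  assumes "\<forall>v\<in>set w. v < N" "a < N" "p < N"
  shows "(a \<le> p \<longrightarrow> path_weight x y z (p # w @ [a]) =
      path_weight x y z (rotate_below N a p # map (rotate_below N a) w @ [0])) \<and>
    (p < a \<longrightarrow> x * path_weight x y z (p # w @ [a]) =
      y * path_weight x y z (rotate_below N a p # map (rotate_below N a) w @ [0]))"
  using assms
proof (induction w arbitrary: p)
  case Nil then show ?case by (auto simp: step_weight_def rotate_below_def mult.commute)
next
  case (Cons q w)
  let ?k = "rotate_below N a"
  have "(a \<le> q \<longrightarrow> path_weight x y z (q # w @ [a]) =
      path_weight x y z (?k q # map ?k w @ [0])) \<and>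
    (q < a \<longrightarrow> x * path_weight x y z (q # w @ [a]) =
      y * path_weight x y z (?k q # map ?k w @ [0]))"
    using Cons by simp
  moreover have "step_weight x y z (?k p) (?k q) =
     (if p < a \<longleftrightarrow> q < a then step_weight x y z p q else if p < a then x else y)"
     "p < a \<longrightarrow> a \<le> q \<longrightarrow> step_weight x y z p q = y"
     "q < a \<longrightarrow> a \<le> p \<longrightarrow> step_weight x y z p q = x"
    using Cons.prems by (auto simp: step_weight_def rotate_below_def)
  ultimately show ?case
    by (cases "p < a"; cases "q < a")
      (simp_all add: mult.left_commute[of x "step_weight x y z p q"]
        mult.left_commute[of y "step_weight x y z p q"] mult.left_commute[of x y])
qed

text \<open>
  The number of descents of a cyclic sequence does not change if its values are cyclically shifted,
  so the entry \<open>a\<close> may be shifted to be the minimum \<open>0\<close>.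
\<close>

lemma sum_cyclic_path_weight:
  fixes x y z :: "'r::comm_semiring_1"
  assumes "finite A" "A \<noteq> {}" "a \<notin> A"
  shows "(\<Sum>w\<in>permutations_of_set A. path_weight x y z (a # w @ [a])) =
    (\<Sum>w\<in>permutations_of_set A. gamma_weight x y w)"
proof -
  obtain N where N: "\<forall>v\<in>insert a A. v < N"
    using assms finite_nat_set_iff_bounded[of "insert a A"] by auto
  let ?k = "rotate_below N a"
  have inj: "inj_on ?k A" using N by (auto simp: inj_on_def rotate_below_def split: if_splits)
  have "(\<Sum>w\<in>permutations_of_set A. path_weight x y z (a # w @ [a])) =
    (\<Sum>w\<in>permutations_of_set A. path_weight x y z (0 # map ?k w @ [0]))"
  proof (intro sum.cong refl)
    fix w assume "w \<in> permutations_of_set A"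
    then have "\<forall>v\<in>set w. v < N" using N by (auto dest: permutations_of_setD)
    from path_weight_rotate_below[OF this, of a a x y z] N
    show "path_weight x y z (a # w @ [a]) = path_weight x y z (0 # map ?k w @ [0])"
      by (simp add: rotate_below_def)
  qed
  also have "\<dots> = (\<Sum>w\<in>permutations_of_set (?k ` A). path_weight x y z (0 # w @ [0]))"
  proof -
    have "inj_on (map ?k) (permutations_of_set A)"
      using inj assms by (intro inj_on_mapI) simp
    then show ?thesis
      using inj by (simp add: permutations_of_set_image_inj sum.reindex)
  qed
  also have "\<dots> = (\<Sum>w\<in>permutations_of_set A. gamma_weight x y w)"
  proof (rule sum_path_weight_eq_sum_gamma_weight)
    show "card (?k ` A) = card A" using inj by (rule card_image)
    show "0 \<notin> ?k ` A" using assms N by (auto simp: rotate_below_def split: if_splits)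
  qed (use assms in auto)
  finally show ?thesis .
qed

section \<open>Statistics as sums over gaps\<close>

lemma card_nth_pairs:
  "card {i. Suc i < length w \<and> P (w ! i) (w ! Suc i)} = length (filter (\<lambda>(p, q). P p q) (pairs w))"
proof -
  have "pairs w ! i = (w ! i, w ! Suc i)" if "Suc i < length w" for i
    using that by (simp add: pairs_def nth_tl)
  then have "{i. Suc i < length w \<and> P (w ! i) (w ! Suc i)} =
    {i. i < length (pairs w) \<and> (case pairs w ! i of (p, q) \<Rightarrow> P p q)}"
    by (auto simp: pairs_def less_diff_conv)
  then show ?thesis by (simp add: length_filter_conv_card)
qed

lemma statistics_pairs:
  "des \<pi> = length (filter (\<lambda>(p, q). p > q) (pairs (padded \<pi>)))"
  "asc \<pi> = length (filter (\<lambda>(p, q). p < q) (pairs (padded \<pi>)))"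
  "plat \<pi> = length (filter (\<lambda>(p, q). p = q) (pairs (padded \<pi>)))"
  unfolding des_def asc_def plat_def card_nth_pairs[symmetric]
  by (simp_all add: padded_def less_Suc_eq_le)

lemma prod_list_step_weight:
  "(\<Prod>(p, q) \<leftarrow> l. step_weight x y z p q) =
    x ^ length (filter (\<lambda>(p, q). p > q) l) * y ^ length (filter (\<lambda>(p, q). p < q) l) *
    z ^ length (filter (\<lambda>(p, q). p = q) l)"
  for x :: "'r::comm_monoid_mult"
proof (induction l)
  case (Cons a l)
  obtain p q where "a = (p, q)" by force
  then show ?case using Cons
    by (cases p q rule: linorder_cases) (simp_all add: step_weight_def ac_simps)
qed simp

lemma path_weight_padded:
  "path_weight x y z (padded \<pi>) = x ^ des \<pi> * y ^ asc \<pi> * z ^ plat \<pi>"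
  unfolding path_weight_def statistics_pairs by (rule prod_list_step_weight)

lemma mset_pairs_padded:
  assumes "0 \<notin> set \<pi>"
  shows "mset (pairs (padded \<pi>)) =
    mset (concat (map (\<lambda>(b, cs). pairs (b # cs @ [b])) (gaps (padded \<pi>))))"
  using mset_pairs_gaps[of 0 \<pi> 0] gaps_padded[OF assms] by (simp add: padded_def)

lemma path_weight_padded_gaps:
  assumes "0 \<notin> set \<pi>"
  shows "path_weight x y z (padded \<pi>) =
    (\<Prod>(b, cs) \<leftarrow> gaps (padded \<pi>). path_weight x y z (b # cs @ [b]))"
proof -
  have "path_weight x y z (padded \<pi>) =
    (\<Prod>(p, q) \<leftarrow> concat (map (\<lambda>(b, cs). pairs (b # cs @ [b])) (gaps (padded \<pi>))). step_weight x y z p q)"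
    unfolding path_weight_def prod_mset_prod_list[symmetric] mset_map mset_pairs_padded[OF assms] ..
  also have "\<dots> = (\<Prod>(b, cs) \<leftarrow> gaps (padded \<pi>). path_weight x y z (b # cs @ [b]))"
  proof -
    have "(\<Prod>(p, q) \<leftarrow> concat (map (\<lambda>(b, cs). pairs (b # cs @ [b])) gs). step_weight x y z p q) =
      (\<Prod>(b, cs) \<leftarrow> gs. path_weight x y z (b # cs @ [b]))" for gs
      by (induction gs) (auto simp: path_weight_def)
    then show ?thesis .
  qed
  finally show ?thesis .
qed

text \<open>Neighbouring labels differ and \<open>b\<close> stands only at the two ends, so a
  plateau arises only if two copies of \<open>b\<close> are adjacent.\<close>

lemma pairs_closed_distinct:
  assumes "distinct (b # cs)"
  shows "length (filter (\<lambda>(p, q). p = q) (pairs (b # cs @ [b]))) = (if cs = [] then 1 else 0)"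
proof -
  have "filter (\<lambda>(p, q). p = q) (pairs (ds @ [b])) = []"
    if "distinct ds" "last ds \<noteq> b" for ds
    using that
  proof (induction ds)
    case (Cons d ds) then show ?case by (cases ds) auto
  qed simp
  moreover have "last (b # cs) \<noteq> b" if "cs \<noteq> []"
    using that assms last_in_set[of cs] by auto
  ultimately show ?thesis using assms by (cases "cs = []") (simp, metis append_Cons list.size(3))
qed

text \<open>
  The labels at which a sibling descent occurs, read off the sequence of blocks of one gap.
\<close>

definition sibling_descent_in :: "nat list \<Rightarrow> nat \<Rightarrow> bool" where
  "sibling_descent_in cs p \<longleftrightarrow> cs \<noteq> [] \<and> last cs = p \<or> (\<exists>q < p. (p, q) \<in> set (pairs cs))"

definition double_descent_in :: "nat list \<Rightarrow> bool" where
  "double_descent_in cs \<longleftrightarrow>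
    (\<exists>c p. (c, p) \<in> set (pairs cs) \<and> p < c \<and> sibling_descent_in cs p)"

lemma set_pairs: "(p, q) \<in> set (pairs w) \<Longrightarrow> p \<in> set w \<and> q \<in> set (tl w)"
  by (auto simp: pairs_def dest: set_zip_leftD set_zip_rightD)

lemma sibling_descent_in_simps [simp]:
  "\<not> sibling_descent_in [] p"
  "sibling_descent_in [a] p \<longleftrightarrow> p = a"
  "sibling_descent_in (a # b # w) p \<longleftrightarrow> p = a \<and> b < a \<or> sibling_descent_in (b # w) p"
  by (auto simp: sibling_descent_in_def)

lemma sibling_descent_in_set: "sibling_descent_in cs p \<Longrightarrow> p \<in> set cs"
  by (auto simp: sibling_descent_in_def dest: set_pairs)

lemma double_descent_in_simps [simp]:
  "\<not> double_descent_in []"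
  "\<not> double_descent_in [a]"
  "a \<notin> set (b # w) \<Longrightarrow> double_descent_in (a # b # w) \<longleftrightarrow>
     b < a \<and> sibling_descent_in (b # w) b \<or> double_descent_in (b # w)"
proof -
  assume a: "a \<notin> set (b # w)"
  have "sibling_descent_in (a # b # w) p \<longleftrightarrow> sibling_descent_in (b # w) p"
    if "(c, p) \<in> set (pairs (b # w))" for c p
    using set_pairs[OF that] a by auto
  then show "double_descent_in (a # b # w) \<longleftrightarrow>
     b < a \<and> sibling_descent_in (b # w) b \<or> double_descent_in (b # w)"
    using a unfolding double_descent_in_def by auto
qed (simp_all add: double_descent_in_def)

lemma finite_sibling_descent_in: "finite {p. sibling_descent_in cs p}"
  by (rule finite_subset[of _ "set cs"]) (auto dest: sibling_descent_in_set)

lemma card_sibling_descent_in_singleton [simp]: "card (Collect (sibling_descent_in [a])) = 1"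
proof -
  have "Collect (sibling_descent_in [a]) = {a}" by auto
  then show ?thesis by simp
qed

lemma card_sibling_descent_in_Cons:
  assumes "a \<notin> set (b # w)"
  shows "card {p. sibling_descent_in (a # b # w) p} =
    (if b < a then Suc (card {p. sibling_descent_in (b # w) p})
     else card {p. sibling_descent_in (b # w) p})"
proof (cases "b < a")
  case True
  then have "{p. sibling_descent_in (a # b # w) p} = insert a {p. sibling_descent_in (b # w) p}"
    by auto
  moreover have "a \<notin> {p. sibling_descent_in (b # w) p}"
    using assms sibling_descent_in_set by blast
  ultimately show ?thesis using True finite_sibling_descent_in by simp
qed simp

text \<open>A leading ascent raises the length by one and leaves the number of sibling descents; a
  descent with the ascent after it raises the length by two and that number by one. So the exponent
  of \<open>x + y\<close> grows by one or stays. The inequality is carried along because that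
  exponent is a truncated difference.\<close>

lemma gamma_weight_eq:
  assumes "distinct cs" "cs \<noteq> []"
  shows "(double_descent_in cs \<longrightarrow> gamma_weight x y cs = 0) \<and>
    (\<not> double_descent_in cs \<longrightarrow>
      2 * card {p. sibling_descent_in cs p} \<le> Suc (length cs) \<and>
      gamma_weight x y cs = (x * y) ^ card {p. sibling_descent_in cs p} *
        (x + y) ^ (Suc (length cs) - 2 * card {p. sibling_descent_in cs p}))"
  using assms
proof (induction x y cs rule: gamma_weight.induct)
    case (3 x y a b)
  then show ?case by (auto simp: card_sibling_descent_in_Cons mult.commute simp del: sibling_descent_in_simps(3))
next
  case (4 x y a b c w)
  define k where "k = card {p. sibling_descent_in (c # w) p}"
  have ab: "card {p. sibling_descent_in (a # b # c # w) p} =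
      (if b < a then Suc (card {p. sibling_descent_in (b # c # w) p})
       else card {p. sibling_descent_in (b # c # w) p})"
    using 4 by (intro card_sibling_descent_in_Cons) auto
  have bc: "card {p. sibling_descent_in (b # c # w) p} = (if c < b then Suc k else k)"
    unfolding k_def using 4 by (intro card_sibling_descent_in_Cons) auto
  have sb: "sibling_descent_in (b # c # w) b \<longleftrightarrow> c < b"
    using 4 sibling_descent_in_set[of "c # w" b] by auto
  have da: "double_descent_in (a # b # c # w) \<longleftrightarrow> b < a \<and> c < b \<or> double_descent_in (b # c # w)"
    using 4 sb by (subst double_descent_in_simps) auto
  consider "a < b" | "b < a" "b < c" | "b < a" "c < b"
    using 4 by (metis distinct_length_2_or_more linorder_cases)
  then show ?case
  proof cases
    case 1
    then have IH: "(double_descent_in (b # c # w) \<longrightarrow> gamma_weight x y (b # c # w) = 0) \<and>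
      (\<not> double_descent_in (b # c # w) \<longrightarrow>
        2 * card {p. sibling_descent_in (b # c # w) p} \<le> Suc (length (b # c # w)) \<and>
        gamma_weight x y (b # c # w) = (x * y) ^ card {p. sibling_descent_in (b # c # w) p} *
        (x + y) ^ (Suc (length (b # c # w)) - 2 * card {p. sibling_descent_in (b # c # w) p}))"
      using 4 by simp
    show ?thesis
      using IH 1 unfolding ab da
      by (auto simp: Suc_diff_le mult.left_commute simp del: sibling_descent_in_simps)
  next
    case 2
    then have IH: "(double_descent_in (c # w) \<longrightarrow> gamma_weight x y (c # w) = 0) \<and>
      (\<not> double_descent_in (c # w) \<longrightarrow> 2 * k \<le> Suc (length (c # w)) \<and>
        gamma_weight x y (c # w) = (x * y) ^ k * (x + y) ^ (Suc (length (c # w)) - 2 * k))"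
      using 4 unfolding k_def by simp
    have "double_descent_in (b # c # w) \<longleftrightarrow> double_descent_in (c # w)"
      using 4 2 by (subst double_descent_in_simps) auto
    then show ?thesis
      using IH 2 unfolding ab da bc by (auto simp: mult.assoc)
  next
    case 3 then show ?thesis using da by auto
  qed
qed auto

text \<open>The blocks of \<open>c\<close> and \<open>p\<close> are neighbours in the same gap.
  Stated by a factorization instead of indices, this can be cut and glued along the block induction;
  the same holds for \<open>closes_gap\<close>, where \<open>p\<close> labels the last block of its
  gap.\<close>

definition sibling :: "'a list \<Rightarrow> 'a \<Rightarrow> 'a \<Rightarrow> bool" where
  "sibling w c p \<longleftrightarrow> (\<exists>u v. w = u @ c # p # v \<and> c \<notin> set (p # v) \<and> p \<notin> set (u @ [c]))"

definition closes_gap :: "'a list \<Rightarrow> 'a \<Rightarrow> bool" where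
  "closes_gap w p \<longleftrightarrow> (\<exists>u q v. w = u @ p # q # v \<and> p \<notin> set (q # v) \<and> q \<in> set u)"

lemma sibling_Cons:
  assumes "b \<notin> set v"
  shows "sibling (b # v) c p \<longleftrightarrow> c = b \<and> v \<noteq> [] \<and> p = hd v \<or> sibling v c p"
proof
  assume "sibling (b # v) c p"
  then obtain \<alpha> \<beta> where "b # v = \<alpha> @ c # p # \<beta>" "c \<notin> set (p # \<beta>)" "p \<notin> set (\<alpha> @ [c])"
    unfolding sibling_def by blast
  then show "c = b \<and> v \<noteq> [] \<and> p = hd v \<or> sibling v c p"
    unfolding sibling_def by (cases \<alpha>) auto
next
  assume "c = b \<and> v \<noteq> [] \<and> p = hd v \<or> sibling v c p"
  then show "sibling (b # v) c p"
  proof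
    assume *: "c = b \<and> v \<noteq> [] \<and> p = hd v"
    then have "b # v = [] @ c # p # tl v" by simp
    moreover have "p \<in> set v" using * by simp
    ultimately show ?thesis using assms * unfolding sibling_def
      by (metis append_Nil empty_iff empty_set list.sel(3) set_ConsD)
  next
    assume "sibling v c p"
    then obtain \<alpha> \<beta> where "v = \<alpha> @ c # p # \<beta>" "c \<notin> set (p # \<beta>)" "p \<notin> set (\<alpha> @ [c])"
      unfolding sibling_def by blast
    then show ?thesis using assms unfolding sibling_def
      by (intro exI[of _ "b # \<alpha>"] exI[of _ \<beta>]) auto
  qed
qed

lemma closes_gap_Cons:
  assumes "b \<notin> set v"
  shows "closes_gap (b # v) p \<longleftrightarrow> closes_gap v p"
proof
  assume "closes_gap (b # v) p"
  then obtain \<alpha> q \<beta> where "b # v = \<alpha> @ p # q # \<beta>" "p \<notin> set (q # \<beta>)" "q \<in> set \<alpha>"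
    unfolding closes_gap_def by blast
  then show "closes_gap v p"
    using assms unfolding closes_gap_def by (cases \<alpha>) auto
next
  assume "closes_gap v p"
  then obtain \<alpha> q \<beta> where "v = \<alpha> @ p # q # \<beta>" "p \<notin> set (q # \<beta>)" "q \<in> set \<alpha>"
    unfolding closes_gap_def by blast
  then show "closes_gap (b # v) p"
    unfolding closes_gap_def by (intro exI[of _ "b # \<alpha>"] exI[of _ q] exI[of _ \<beta>]) auto
qed

text \<open>The adjacent pair \<open>c\<close>, \<open>p\<close> starts at the first
  \<open>b\<close>, lies in the remainder \<open>b # v\<close>, straddles the end of
  \<open>u\<close>, or lies inside \<open>u\<close>.\<close>

lemma split_eq_cases:
  assumes "b # u @ b # v = \<alpha> @ c # p # \<beta>"
  obtains "\<alpha> = []" "c = b" "p # \<beta> = u @ b # v"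
    | \<gamma> where "\<alpha> = b # u @ \<gamma>" "b # v = \<gamma> @ c # p # \<beta>"
    | \<alpha>' where "\<alpha> = b # \<alpha>'" "u = \<alpha>' @ [c]" "p = b" "\<beta> = v"
    | \<alpha>' \<gamma> where "\<alpha> = b # \<alpha>'" "u = \<alpha>' @ c # p # \<gamma>" "\<beta> = \<gamma> @ b # v"
proof (cases \<alpha>)
  case Nil then show ?thesis using assms that(1) by auto
next
  case (Cons d \<alpha>')
  then have "d = b" and "u @ b # v = \<alpha>' @ c # p # \<beta>" using assms by auto
  from this(2) consider us where "u = \<alpha>' @ us" "us @ b # v = c # p # \<beta>"
    | us where "u @ us = \<alpha>'" "b # v = us @ c # p # \<beta>"
    unfolding append_eq_append_conv2 by blast
  then show ?thesis
  proof cases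
    case (1 us)
    consider "us = []" | "us = [c]" | us' where "us = c # p # us'"
      using 1(2) by (cases us; cases "tl us") auto
    then show ?thesis
    proof cases
      case 1 then show ?thesis using that(2)[of "[]"] \<open>u = \<alpha>' @ us\<close> \<open>us @ b # v = _\<close> Cons \<open>d = b\<close> by simp
    next
      case 2 then show ?thesis using that(3)[of \<alpha>'] \<open>u = \<alpha>' @ us\<close> \<open>us @ b # v = _\<close> Cons \<open>d = b\<close> by simp
    next
      case 3 then show ?thesis using that(4)[of \<alpha>' us'] \<open>u = \<alpha>' @ us\<close> \<open>us @ b # v = _\<close> Cons \<open>d = b\<close> by simp
    qed
  next
    case (2 us) then show ?thesis using that(2)[of us] Cons \<open>d = b\<close> by auto
  qed
qed

text \<open>No new pair arises at the seams: the first \<open>b\<close> is not a last copy, and the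
  second one is not a first copy.\<close>

lemma sibling_split:
  assumes "b \<notin> set u" "set u \<inter> set v = {}"
  shows "sibling (b # u @ b # v) c p \<longleftrightarrow> sibling u c p \<or> sibling (b # v) c p"
proof
  assume "sibling (b # u @ b # v) c p"
  then obtain \<alpha> \<beta> where w: "b # u @ b # v = \<alpha> @ c # p # \<beta>" "c \<notin> set (p # \<beta>)" "p \<notin> set (\<alpha> @ [c])"
    unfolding sibling_def by blast
  from w(1) show "sibling u c p \<or> sibling (b # v) c p"
  proof (cases rule: split_eq_cases)
    case 1 then show ?thesis using w(2) by simp
  next
    case (2 \<gamma>)
    then have "sibling (b # v) c p" using w(2,3) unfolding sibling_def
      by (intro exI[of _ \<gamma>] exI[of _ \<beta>]) auto
    then show ?thesis ..
  next
    case 3 then show ?thesis using w(3) by simp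
  next
    case (4 \<alpha>' \<gamma>)
    then have "sibling u c p" using w(2,3) unfolding sibling_def
      by (intro exI[of _ \<alpha>'] exI[of _ \<gamma>]) auto
    then show ?thesis ..
  qed
next
  assume "sibling u c p \<or> sibling (b # v) c p"
  then show "sibling (b # u @ b # v) c p"
  proof
    assume "sibling u c p"
    then obtain \<alpha> \<beta> where w: "u = \<alpha> @ c # p # \<beta>" "c \<notin> set (p # \<beta>)" "p \<notin> set (\<alpha> @ [c])"
      unfolding sibling_def by blast
    then have "c \<notin> set (b # v)" "p \<noteq> b" using assms by auto
    then show ?thesis using w unfolding sibling_def
      by (intro exI[of _ "b # \<alpha>"] exI[of _ "\<beta> @ b # v"]) auto
  next
    assume "sibling (b # v) c p"
    then obtain \<alpha> \<beta> where w: "b # v = \<alpha> @ c # p # \<beta>" "c \<notin> set (p # \<beta>)" "p \<notin> set (\<alpha> @ [c])"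
      unfolding sibling_def by blast
    then have "p \<in> set v \<and> p \<noteq> b" by (cases \<alpha>) auto
    then show ?thesis using w assms unfolding sibling_def
      by (intro exI[of _ "b # u @ \<alpha>"] exI[of _ \<beta>]) auto
  qed
qed

text \<open>The one new contribution is the last letter of \<open>u\<close>, which stands before the
  second \<open>b\<close> and so closes the gap that is cut off.\<close>

lemma closes_gap_split:
  assumes "b \<notin> set u" "set u \<inter> set v = {}"
  shows "closes_gap (b # u @ b # v) p \<longleftrightarrow>
    u \<noteq> [] \<and> p = last u \<or> closes_gap u p \<or> closes_gap (b # v) p"
proof
  assume "closes_gap (b # u @ b # v) p"
  then obtain \<alpha> q \<beta> where w: "b # u @ b # v = \<alpha> @ p # q # \<beta>" "p \<notin> set (q # \<beta>)" "q \<in> set \<alpha>"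
    unfolding closes_gap_def by blast
  from w(1) show "u \<noteq> [] \<and> p = last u \<or> closes_gap u p \<or> closes_gap (b # v) p"
  proof (cases rule: split_eq_cases)
    case 1 then show ?thesis using w(3) by simp
  next
    case (2 \<gamma>)
    \<comment> \<open>The earlier copy of \<open>q\<close> must be found in \<open>b # v\<close>
      already, because \<open>u\<close> shares no letter with \<open>v\<close>.\<close>
    have "q \<in> set \<gamma>"
    proof (cases \<gamma>)
      case Nil
      then have "q \<in> set v" "q \<noteq> b" using 2 w(2) by auto
      then show ?thesis using assms(2) 2 w(3) Nil by auto
    next
      case (Cons d \<gamma>')
      then have "q \<in> set v" "d = b" using 2 by auto
      then show ?thesis using assms(2) 2 w(3) Cons by auto
    qed
    then have "closes_gap (b # v) p" using 2 w(2) unfolding closes_gap_def by blast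
    then show ?thesis by simp
  next
    case 3 then show ?thesis by simp
  next
    case (4 \<alpha>' \<gamma>)
    then have "closes_gap u p" using w(2,3) assms(1) unfolding closes_gap_def
      by (intro exI[of _ \<alpha>'] exI[of _ q] exI[of _ \<gamma>]) auto
    then show ?thesis by simp
  qed
next
  assume "u \<noteq> [] \<and> p = last u \<or> closes_gap u p \<or> closes_gap (b # v) p"
  then consider "u \<noteq> []" "p = last u" | "closes_gap u p" | "closes_gap (b # v) p" by blast
  then show "closes_gap (b # u @ b # v) p"
  proof cases
    case 1
    then obtain u' where u: "u = u' @ [p]" by (metis append_butlast_last_id)
    then have "p \<notin> set (b # v)" using assms by auto
    then show ?thesis using u unfolding closes_gap_def
      by (intro exI[of _ "b # u'"] exI[of _ b] exI[of _ v]) simp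
  next
    case 2
    then obtain \<alpha> q \<beta> where w: "u = \<alpha> @ p # q # \<beta>" "p \<notin> set (q # \<beta>)" "q \<in> set \<alpha>"
      unfolding closes_gap_def by blast
    then have "p \<notin> set (b # v)" using assms by auto
    then show ?thesis using w unfolding closes_gap_def
      by (intro exI[of _ "b # \<alpha>"] exI[of _ q] exI[of _ "\<beta> @ b # v"]) auto
  next
    case 3
    then obtain \<alpha> q \<beta> where w: "b # v = \<alpha> @ p # q # \<beta>" "p \<notin> set (q # \<beta>)" "q \<in> set \<alpha>"
      unfolding closes_gap_def by blast
    then show ?thesis unfolding closes_gap_def
      by (intro exI[of _ "b # u @ \<alpha>"] exI[of _ q] exI[of _ \<beta>]) auto
  qed
qed

lemma sibling_iff:
  "noncrossing w \<Longrightarrow> sibling w c p \<longleftrightarrow>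
    (c, p) \<in> set (pairs (tops w)) \<or> (\<exists>(b, cs) \<in> set (gaps w). (c, p) \<in> set (pairs cs))"
proof (induction w rule: block_induct)
  case Nil then show ?case by (simp add: sibling_def)
next
  case (Cons b v)
  have "(c, p) \<in> set (pairs (b # tops v)) \<longleftrightarrow>
      c = b \<and> v \<noteq> [] \<and> p = hd v \<or> (c, p) \<in> set (pairs (tops v))"
  proof (cases "v = []")
    case False
    then obtain t where "tops v = hd v # t" using hd_tops[of v] by (cases "tops v") auto
    then show ?thesis using False by auto
  qed simp
  then show ?case
    using Cons by (auto simp: sibling_Cons noncrossing_Cons_notin)
next
  case (split b u v)
  then show ?case by (auto simp: noncrossing_split sibling_split)
qed

lemma closes_gap_iff:
  "noncrossing w \<Longrightarrow> closes_gap w p \<longleftrightarrow> (\<exists>(b, cs) \<in> set (gaps w). cs \<noteq> [] \<and> last cs = p)"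
proof (induction w rule: block_induct)
  case Nil then show ?case by (simp add: closes_gap_def)
next
  case (Cons b v) then show ?case by (simp add: closes_gap_Cons noncrossing_Cons_notin)
next
  case (split b u v)
  then show ?case using last_tops[of u] by (auto simp: noncrossing_split closes_gap_split)
qed

section \<open>From positions in the padded word to letters\<close>

lemma last_copy_iff: "last_copy w i \<longleftrightarrow> w ! i \<notin> set (drop (Suc i) w)"
proof -
  have "set (drop (Suc i) w) = (!) w ` {Suc i..<length w}"
    by (metis drop_map map_nth set_map set_upt drop_upt add_0)
  then have "w ! i \<in> set (drop (Suc i) w) \<longleftrightarrow> (\<exists>k. i < k \<and> k < length w \<and> w ! i = w ! k)"
    by (simp only: image_iff Bex_def atLeastLessThan_iff Suc_le_eq conj_assoc)
  then show ?thesis unfolding last_copy_def by metis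
qed

lemma first_copy_iff: "i < length w \<Longrightarrow> first_copy w i \<longleftrightarrow> w ! i \<notin> set (take i w)"
  unfolding first_copy_def in_set_conv_nth by auto

lemma take_nth_nth_drop:
  "Suc i < length w \<Longrightarrow> w = take i w @ w ! i # w ! Suc i # drop (Suc (Suc i)) w"
  by (simp add: Cons_nth_drop_Suc)

lemma sibling_iff_index:
  "sibling w c p \<longleftrightarrow> (\<exists>i. Suc i < length w \<and> w ! i = c \<and> w ! Suc i = p \<and>
     last_copy w i \<and> first_copy w (Suc i))"
proof
  assume "sibling w c p"
  then obtain u v where "w = u @ c # p # v" "c \<notin> set (p # v)" "p \<notin> set (u @ [c])"
    unfolding sibling_def by blast
  then show "\<exists>i. Suc i < length w \<and> w ! i = c \<and> w ! Suc i = p \<and> last_copy w i \<and> first_copy w (Suc i)"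
    by (intro exI[of _ "length u"]) (simp add: last_copy_iff first_copy_iff nth_append)
next
  assume "\<exists>i. Suc i < length w \<and> w ! i = c \<and> w ! Suc i = p \<and> last_copy w i \<and> first_copy w (Suc i)"
  then obtain i where i: "Suc i < length w" "w ! i = c" "w ! Suc i = p" "last_copy w i" "first_copy w (Suc i)"
    by blast
  then have "w = take i w @ c # p # drop (Suc (Suc i)) w" using take_nth_nth_drop by metis
  moreover have "c \<notin> set (p # drop (Suc (Suc i)) w)"
    using i by (metis Cons_nth_drop_Suc Suc_lessD last_copy_iff)
  moreover have "p \<notin> set (take i w @ [c])"
    using i by (metis Suc_lessD first_copy_iff take_Suc_conv_app_nth)
  ultimately show "sibling w c p" unfolding sibling_def by blast
qed

lemma closes_gap_iff_index:
  "closes_gap w p \<longleftrightarrow> (\<exists>i. Suc i < length w \<and> w ! i = p \<and> last_copy w i \<and> \<not> first_copy w (Suc i))"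
proof
  assume "closes_gap w p"
  then obtain u q v where "w = u @ p # q # v" "p \<notin> set (q # v)" "q \<in> set u"
    unfolding closes_gap_def by blast
  then show "\<exists>i. Suc i < length w \<and> w ! i = p \<and> last_copy w i \<and> \<not> first_copy w (Suc i)"
    by (intro exI[of _ "length u"]) (simp add: last_copy_iff first_copy_iff nth_append)
next
  assume "\<exists>i. Suc i < length w \<and> w ! i = p \<and> last_copy w i \<and> \<not> first_copy w (Suc i)"
  then obtain i where i: "Suc i < length w" "w ! i = p" "last_copy w i" "\<not> first_copy w (Suc i)"
    by blast
  then have "w = take i w @ p # w ! Suc i # drop (Suc (Suc i)) w" using take_nth_nth_drop by metis
  moreover have p: "p \<notin> set (w ! Suc i # drop (Suc (Suc i)) w)"
    using i by (metis Cons_nth_drop_Suc Suc_lessD last_copy_iff)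
  moreover have "w ! Suc i \<in> set (take i w @ [p])"
    using i by (metis Suc_lessD first_copy_iff take_Suc_conv_app_nth)
  then have "w ! Suc i \<in> set (take i w)" using p by auto
  ultimately show "closes_gap w p" unfolding closes_gap_def by blast
qed

lemma last_copy_inj:
  "last_copy w i \<Longrightarrow> last_copy w j \<Longrightarrow> i < length w \<Longrightarrow> j < length w \<Longrightarrow> w ! i = w ! j \<Longrightarrow> i = j"
  unfolding last_copy_def by (metis linorder_neqE_nat)

text \<open>The final 0 is a later copy. This excludes index 0 and absorbs the lower bound in the
  definitions of sibling descents.\<close>

lemma not_last_copy_padded_0: "\<not> last_copy (padded \<pi>) 0"
  unfolding last_copy_def padded_def by (auto intro!: exI[of _ "Suc (length \<pi>)"])

lemma sibling_descent_I_iff: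
  "sibling_descent_I \<pi> i \<longleftrightarrow> Suc i < length (padded \<pi>) \<and> last_copy (padded \<pi>) i \<and>
     first_copy (padded \<pi>) (Suc i) \<and> padded \<pi> ! Suc i < padded \<pi> ! i"
  unfolding sibling_descent_I_def using not_last_copy_padded_0[of \<pi>]
  by (cases i) (auto simp: padded_def less_Suc_eq_le)

lemma sibling_descent_II_iff:
  "sibling_descent_II \<pi> i \<longleftrightarrow> Suc i < length (padded \<pi>) \<and> last_copy (padded \<pi>) i \<and>
     \<not> first_copy (padded \<pi>) (Suc i)"
  unfolding sibling_descent_II_def using not_last_copy_padded_0[of \<pi>]
  by (cases i) (auto simp: padded_def less_Suc_eq_le)

lemma sibling_descent_I_label:
  "(\<exists>i. sibling_descent_I \<pi> i \<and> padded \<pi> ! i = c \<and> padded \<pi> ! Suc i = p) \<longleftrightarrow>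
    sibling (padded \<pi>) c p \<and> p < c"
  unfolding sibling_descent_I_iff sibling_iff_index by blast

text \<open>Sibling descents are recorded by letters: their positions are last copies, so no letter
  is hit twice.\<close>

definition descent_label :: "nat list \<Rightarrow> nat \<Rightarrow> bool" where
  "descent_label \<pi> p \<longleftrightarrow> closes_gap (padded \<pi>) p \<or> (\<exists>q < p. sibling (padded \<pi>) p q)"

lemma sibling_descent_label:
  "(\<exists>i. sibling_descent \<pi> i \<and> padded \<pi> ! i = p) \<longleftrightarrow> descent_label \<pi> p"
  unfolding sibling_descent_def descent_label_def closes_gap_iff_index sibling_descent_II_iff
  using sibling_descent_I_label[of \<pi> p] by blast

lemma sibling_descentD:
  "sibling_descent \<pi> i \<Longrightarrow> Suc i < length (padded \<pi>) \<and> last_copy (padded \<pi>) i"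
  by (auto simp: sibling_descent_def sibling_descent_I_iff sibling_descent_II_iff)

lemma sd_eq_card_label: "sd \<pi> = card {p. descent_label \<pi> p}"
proof -
  have "bij_betw (\<lambda>i. padded \<pi> ! i) {i. sibling_descent \<pi> i} {p. descent_label \<pi> p}"
    unfolding bij_betw_def
  proof
    show "inj_on ((!) (padded \<pi>)) {i. sibling_descent \<pi> i}"
    proof (rule inj_onI)
      fix i j assume "i \<in> {i. sibling_descent \<pi> i}" "j \<in> {i. sibling_descent \<pi> i}"
        and eq: "padded \<pi> ! i = padded \<pi> ! j"
      then show "i = j"
        using sibling_descentD[of \<pi> i] sibling_descentD[of \<pi> j]
        by (intro last_copy_inj[OF _ _ _ _ eq]) simp_all
    qed
    show "(!) (padded \<pi>) ` {i. sibling_descent \<pi> i} = {p. descent_label \<pi> p}"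
      unfolding sibling_descent_label[symmetric] by blast
  qed
  then show ?thesis unfolding sd_def by (rule bij_betw_same_card)
qed

text \<open>The two descents of a double one enclose the block of \<open>p\<close>: the first leads
  into its first copy, the second starts at its last copy. On letters this is a larger left sibling
  \<open>c\<close> together with a sibling descent at \<open>p\<close>.\<close>

lemma dsd_eq_0_iff:
  "dsd \<pi> = 0 \<longleftrightarrow> \<not> (\<exists>c p. sibling (padded \<pi>) c p \<and> p < c \<and> descent_label \<pi> p)"
proof -
  have "finite {i. double_sibling_descent \<pi> i}"
    by (rule finite_subset[of _ "{..length \<pi>}"]) (auto simp: double_sibling_descent_def)
  then have "dsd \<pi> = 0 \<longleftrightarrow> \<not> (\<exists>i. double_sibling_descent \<pi> i)" by (simp add: dsd_def)
  also have "(\<exists>i. double_sibling_descent \<pi> i) \<longleftrightarrow>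
    (\<exists>c p. sibling (padded \<pi>) c p \<and> p < c \<and> descent_label \<pi> p)"
  proof
    assume "\<exists>i. double_sibling_descent \<pi> i"
    then obtain i f where i: "sibling_descent \<pi> i" "padded \<pi> ! f = padded \<pi> ! i"
        "sibling_descent_I \<pi> (f - 1)"
      unfolding double_sibling_descent_def by blast
    \<comment> \<open>The type I descent has index at least 1, so the truncated \<open>f - 1\<close>
      really is the predecessor of \<open>f\<close>.\<close>
    then have "1 \<le> f - 1" by (simp only: sibling_descent_I_def)
    then have "Suc (f - 1) = f" by linarith
    then have "sibling (padded \<pi>) (padded \<pi> ! (f - 1)) (padded \<pi> ! i) \<and>
        padded \<pi> ! i < padded \<pi> ! (f - 1)"
      using i sibling_descent_I_label[of \<pi> "padded \<pi> ! (f - 1)" "padded \<pi> ! i"] by metis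
    moreover have "descent_label \<pi> (padded \<pi> ! i)" using i sibling_descent_label by blast
    ultimately show "\<exists>c p. sibling (padded \<pi>) c p \<and> p < c \<and> descent_label \<pi> p" by blast
  next
    assume "\<exists>c p. sibling (padded \<pi>) c p \<and> p < c \<and> descent_label \<pi> p"
    then obtain c p where cp: "sibling (padded \<pi>) c p" "p < c" "descent_label \<pi> p" by blast
    then obtain e where e: "sibling_descent_I \<pi> e" "padded \<pi> ! Suc e = p"
      using sibling_descent_I_label[of \<pi> c p] by blast
    obtain i where i: "sibling_descent \<pi> i" "padded \<pi> ! i = p"
      using cp sibling_descent_label by blast
    have fe: "first_copy (padded \<pi>) (Suc e)" "1 \<le> e" using e by (auto simp: sibling_descent_I_def)
    then have "Suc e \<le> i"
      using e i unfolding first_copy_def by (metis not_less)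
    then have "double_sibling_descent \<pi> i"
      unfolding double_sibling_descent_def using e i fe
      by (auto simp: sibling_descent_def sibling_descent_I_def sibling_descent_II_def intro!: exI[of _ "Suc e"])
    then show "\<exists>i. double_sibling_descent \<pi> i" by blast
  qed
  finally show ?thesis .
qed

lemma noncrossing_padded: "noncrossing \<pi> \<Longrightarrow> a \<notin> set \<pi> \<Longrightarrow> noncrossing (a # \<pi> @ [a])"
  using noncrossing_split[of a \<pi> "[]"] by (simp add: noncrossing_Cons_notin)

lemma labels_gaps_padded:
  assumes "noncrossing \<pi>" "0 \<notin> set \<pi>"
  shows "distinct (concat (map snd (gaps (padded \<pi>))))"
    and "(b, cs) \<in> set (gaps (padded \<pi>)) \<Longrightarrow> distinct (b # cs)"
proof -
  have nc: "noncrossing (padded \<pi>)" using noncrossing_padded assms by (simp add: padded_def)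
  from labels_gaps[OF nc] show d: "distinct (concat (map snd (gaps (padded \<pi>))))" by simp
  assume *: "(b, cs) \<in> set (gaps (padded \<pi>))"
  then have "cs \<in> set (map snd (gaps (padded \<pi>)))" by force
  then have "distinct cs" using d by (simp only: distinct_concat_iff)
  then show "distinct (b # cs)" using gaps_parent_notin[OF nc *] by simp
qed

lemma descent_label_iff:
  assumes "noncrossing \<pi>" "0 \<notin> set \<pi>"
  shows "descent_label \<pi> p \<longleftrightarrow> (\<exists>cs \<in> snd ` set (gaps (padded \<pi>)). sibling_descent_in cs p)"
proof -
  have nc: "noncrossing (padded \<pi>)" using noncrossing_padded assms by (simp add: padded_def)
  have "tops (padded \<pi>) = [0]" using assms by (simp add: padded_def)
  then show ?thesis
    unfolding descent_label_def sibling_iff[OF nc] closes_gap_iff[OF nc] sibling_descent_in_def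
    by force
qed

lemma distinct_concat_unique:
  "distinct (concat xss) \<Longrightarrow> xs \<in> set xss \<Longrightarrow> ys \<in> set xss \<Longrightarrow> a \<in> set xs \<Longrightarrow> a \<in> set ys \<Longrightarrow>
    xs = ys"
  by (induction xss) auto

text \<open>A priori the two descents could be read off different gaps; both gaps contain the label
  \<open>p\<close>, and every label belongs to one gap only.\<close>

lemma dsd_eq_0_iff_gaps:
  assumes "noncrossing \<pi>" "0 \<notin> set \<pi>"
  shows "dsd \<pi> = 0 \<longleftrightarrow> (\<forall>cs \<in> snd ` set (gaps (padded \<pi>)). \<not> double_descent_in cs)"
proof -
  have nc: "noncrossing (padded \<pi>)" using noncrossing_padded assms by (simp add: padded_def)
  have t: "tops (padded \<pi>) = [0]" using assms by (simp add: padded_def)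
  have unique: "cs = ds" if "cs \<in> snd ` set (gaps (padded \<pi>))" "ds \<in> snd ` set (gaps (padded \<pi>))"
    "p \<in> set cs" "p \<in> set ds" for cs ds p
    by (rule distinct_concat_unique[OF labels_gaps_padded(1)[OF assms]]) (use that in simp_all)
  have "sibling (padded \<pi>) c p \<longleftrightarrow> (\<exists>cs \<in> snd ` set (gaps (padded \<pi>)). (c, p) \<in> set (pairs cs))" for c p
    unfolding sibling_iff[OF nc] t by force
  then have dsd: "dsd \<pi> = 0 \<longleftrightarrow> \<not> (\<exists>cs \<in> snd ` set (gaps (padded \<pi>)). \<exists>ds \<in> snd ` set (gaps (padded \<pi>)).
      \<exists>c p. (c, p) \<in> set (pairs cs) \<and> p < c \<and> sibling_descent_in ds p)"
    unfolding dsd_eq_0_iff descent_label_iff[OF assms] by blast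
  have *: "cs = ds"
    if "cs \<in> snd ` set (gaps (padded \<pi>))" "ds \<in> snd ` set (gaps (padded \<pi>))"
      "(c, p) \<in> set (pairs cs)" "sibling_descent_in ds p" for cs ds c p
  proof -
    have "p \<in> set cs" using set_pairs[OF that(3)] by (cases cs) auto
    moreover have "p \<in> set ds" using that(4) by (rule sibling_descent_in_set)
    ultimately show ?thesis using unique that(1,2) by blast
  qed
  have "(\<exists>cs \<in> snd ` set (gaps (padded \<pi>)). \<exists>ds \<in> snd ` set (gaps (padded \<pi>)).
      \<exists>c p. (c, p) \<in> set (pairs cs) \<and> p < c \<and> sibling_descent_in ds p) \<longleftrightarrow>
    (\<exists>cs \<in> snd ` set (gaps (padded \<pi>)). double_descent_in cs)"
  (is "?l \<longleftrightarrow> ?r")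
  proof
    assume ?l
    then obtain cs ds c p where cd: "cs \<in> snd ` set (gaps (padded \<pi>))"
      "ds \<in> snd ` set (gaps (padded \<pi>))" "(c, p) \<in> set (pairs cs)" "p < c" "sibling_descent_in ds p"
      by (elim bexE exE conjE)
    then have "cs = ds" by (intro *)
    then have "double_descent_in cs" unfolding double_descent_in_def using cd by blast
    then show ?r using cd(1) by (rule bexI)
  next
    assume ?r
    then obtain cs where cs: "cs \<in> snd ` set (gaps (padded \<pi>))" "double_descent_in cs"
      by (elim bexE)
    then obtain c p where "(c, p) \<in> set (pairs cs)" "p < c" "sibling_descent_in cs p"
      unfolding double_descent_in_def by (elim exE conjE)
    then show ?l using cs(1) by (intro bexI exI conjI)
  qed
  then show ?thesis unfolding dsd by blast
qed

lemma card_sibling_descent_in_concat: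
  "distinct (concat css) \<Longrightarrow> card {p. \<exists>cs \<in> set css. sibling_descent_in cs p} =
    (\<Sum>cs \<leftarrow> css. card {p. sibling_descent_in cs p})"
proof (induction css)
  case (Cons cs css)
  have "{p. \<exists>ds \<in> set (cs # css). sibling_descent_in ds p} =
    {p. sibling_descent_in cs p} \<union> {p. \<exists>ds \<in> set css. sibling_descent_in ds p}" by auto
  moreover have "{p. sibling_descent_in cs p} \<inter> {p. \<exists>ds \<in> set css. sibling_descent_in ds p} = {}"
    using Cons.prems by (auto dest!: sibling_descent_in_set)
  moreover have "finite {p. \<exists>ds \<in> set css. sibling_descent_in ds p}"
    by (rule finite_subset[of _ "\<Union>ds\<in>set css. set ds"]) (auto dest: sibling_descent_in_set)
  ultimately show ?case
    using Cons by (simp add: card_Un_disjoint finite_sibling_descent_in)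
qed simp

section \<open>Reordering the blocks of a gap\<close>

text \<open>The multiplicities \<open>m\<close> stay fixed and only \<open>S\<close> varies, so that
  the pieces of a word are again of this form, for smaller sets.\<close>

definition words :: "('a \<Rightarrow> nat) \<Rightarrow> 'a set \<Rightarrow> 'a list set" where
  "words m S = {w. noncrossing w \<and> (\<forall>i. count_list w i = (if i \<in> S then m i else 0))}"

text \<open>The words that may follow a copy of \<open>b\<close> when \<open>r\<close> copies of \<open>b\<close> are still to come.\<close>

definition tails :: "('a \<Rightarrow> nat) \<Rightarrow> 'a \<Rightarrow> nat \<Rightarrow> 'a set \<Rightarrow> 'a list set" where
  "tails m b r S = {w. noncrossing (b # w) \<and>
     (\<forall>i. count_list w i = (if i = b then r else if i \<in> S then m i else 0))}"

lemma set_count_list: "set w = {i. count_list w i \<noteq> 0}"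
  by (auto simp: count_list_0_iff)

lemma finite_count_list_eq:
  assumes "finite A" "\<And>i. i \<notin> A \<Longrightarrow> c i = 0"
  shows "finite {w. \<forall>i. count_list w i = c i}"
proof (rule finite_subset)
  show "{w. \<forall>i. count_list w i = c i} \<subseteq> {w. set w \<subseteq> A \<and> length w = sum c A}"
  proof safe
    fix w x assume w: "\<forall>i. count_list w i = c i"
    show A: "x \<in> A" if "x \<in> set w" for x
      using that w assms(2) by (metis count_list_0_iff)
    then have "set w \<subseteq> A" by blast
    from sum_count_set[OF this assms(1)] show "length w = sum c A" using w by simp
  qed
  show "finite {w. set w \<subseteq> A \<and> length w = sum c A}"
    by (rule finite_lists_length_eq) fact
qed

lemma finite_words: "finite S \<Longrightarrow> finite (words m S)"
  unfolding words_def
  by (rule finite_subset[OF _ finite_count_list_eq[of S "\<lambda>i. if i \<in> S then m i else 0"]]) auto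

lemma finite_tails: "finite S \<Longrightarrow> finite (tails m b r S)"
  unfolding tails_def
  by (rule finite_subset[OF _ finite_count_list_eq[of "insert b S"
    "\<lambda>i. if i = b then r else if i \<in> S then m i else 0"]]) auto

lemma set_words: "w \<in> words m S \<Longrightarrow> \<forall>i. m i > 0 \<Longrightarrow> set w = S"
  unfolding set_count_list words_def by auto

lemma set_tails: "w \<in> tails m b r S \<Longrightarrow> set w \<subseteq> insert b S"
  unfolding set_count_list tails_def by (auto split: if_splits)

lemma tails_0: "b \<notin> S \<Longrightarrow> tails m b 0 S = words m S"
proof -
  assume "b \<notin> S"
  then have "(if i = b then 0 else if i \<in> S then m i else 0) = (if i \<in> S then m i else 0)" for i
    by simp
  moreover have "noncrossing (b # w) \<longleftrightarrow> noncrossing w"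
    if "\<forall>i. count_list w i = (if i \<in> S then m i else 0)" for w
  proof (rule noncrossing_Cons_notin)
    have "count_list w b = 0" using that \<open>b \<notin> S\<close> by simp
    then show "b \<notin> set w" by (simp only: count_list_0_iff not_False_eq_True)
  qed
  ultimately show ?thesis
    unfolding tails_def words_def by (intro Collect_cong) (simp only:, blast)
qed

lemma words_eq_Cons:
  assumes "b \<in> S" "\<forall>i. m i > 0"
  shows "b # w \<in> words m S \<longleftrightarrow> w \<in> tails m b (m b - 1) (S - {b})"
proof -
  have "count_list (b # w) i = (if i \<in> S then m i else 0) \<longleftrightarrow>
    count_list w i = (if i = b then m b - 1 else if i \<in> S - {b} then m i else 0)" for i
    using assms spec[OF assms(2), of b] by auto
  then show ?thesis by (simp add: words_def tails_def)
qed

text \<open>By noncrossing, the gap up to the next \<open>b\<close> contains all copies of its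
  letters. Hence the two pieces use complementary subsets of \<open>S\<close>, each letter with full
  multiplicity.\<close>

lemma sum_tails_Suc:
  fixes f :: "'a list \<Rightarrow> 'r::comm_monoid_add"
  assumes "finite S" "b \<notin> S" and m: "\<forall>i. m i > 0"
  shows "(\<Sum>w\<in>tails m b (Suc r) S. f w) =
    (\<Sum>U\<in>Pow S. \<Sum>u\<in>words m U. \<Sum>v\<in>tails m b r (S - U). f (u @ b # v))"
proof -
  define T where "T = (SIGMA U:Pow S. words m U \<times> tails m b r (S - U))"
  define h where "h = (\<lambda>(U :: 'a set, u, v). u @ b # v)"
  have "inj_on h T"
  proof (rule inj_onI)
    fix p p' assume *: "p \<in> T" "p' \<in> T" "h p = h p'"
    obtain U u v U' u' v' where p: "p = (U, u, v)" "p' = (U', u', v')"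
      by (metis prod_cases3)
    \<comment> \<open>Positivity of \<open>m\<close> makes every letter of \<open>U\<close> occur,
      so \<open>U\<close> can be read off \<open>u\<close>.\<close>
    then have U: "U = set u" "U' = set u'" "U \<subseteq> S" "U' \<subseteq> S"
      using * m by (auto simp: T_def dest: set_words)
    then have "b \<notin> set u" "b \<notin> set u'" using assms by auto
    moreover have "u @ b # v = u' @ b # v'" using * p by (simp add: h_def)
    ultimately have "u = u' \<and> v = v'" by (rule append_Cons_eq_imp)
    then show "p = p'" using U p by simp
  qed
  moreover have "tails m b (Suc r) S = h ` T"
  proof (intro equalityI subsetI)
    fix w assume w: "w \<in> tails m b (Suc r) S"
    then have c: "count_list w i = (if i = b then Suc r else if i \<in> S then m i else 0)" for i
      by (simp add: tails_def)
    have "count_list w b \<noteq> 0" by (simp add: c)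
    then have "b \<in> set w" by (metis count_list_0_iff)
    then obtain u v where uv: "w = u @ b # v" "b \<notin> set u" by (meson split_list_first)
    then have nc: "noncrossing u" "noncrossing (b # v)" "set u \<inter> set v = {}"
      using w by (simp_all add: tails_def noncrossing_split)
    \<comment> \<open>At most one of the two terms is nonzero, since \<open>u\<close> and
      \<open>v\<close> share no letter.\<close>
    have s: "count_list u i + count_list v i = (if i = b then r else if i \<in> S then m i else 0)" for i
      using c[of i] uv by (auto split: if_splits)
    have u0: "count_list u i = 0 \<longleftrightarrow> i \<notin> set u" for i by (simp add: count_list_0_iff)
    have v0: "count_list v i = 0" if "i \<in> set u" for i using that nc by (auto simp: count_list_0_iff)
    have US: "set u \<subseteq> S"
    proof
      fix i assume "i \<in> set u"
      then have "count_list u i \<noteq> 0" "i \<noteq> b" using uv by (auto simp: u0)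
      then show "i \<in> S" using s[of i] by (auto split: if_splits)
    qed
    have "count_list u i = (if i \<in> set u then m i else 0) \<and>
      count_list v i = (if i = b then r else if i \<in> S - set u then m i else 0)" for i
    proof (cases "i \<in> set u")
      case True
      then have "count_list v i = 0" "i \<noteq> b" "i \<in> S" using v0 US uv(2) by blast+
      then show ?thesis using s[of i] True by simp
    next
      case False
      then have "count_list u i = 0" unfolding u0 .
      then show ?thesis using s[of i] False by simp
    qed
    then have "u \<in> words m (set u)" "v \<in> tails m b r (S - set u)"
      using nc by (simp_all add: words_def tails_def)
    then have "(set u, u, v) \<in> T" "h (set u, u, v) = w"
      using uv US by (simp_all add: T_def h_def)
    then show "w \<in> h ` T" by blast
  next
    fix w assume "w \<in> h ` T"
    then obtain U u v where U: "U \<subseteq> S" "u \<in> words m U" "v \<in> tails m b r (S - U)" "w = u @ b # v"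
      by (auto simp: h_def T_def)
    have u: "set u = U" using U m by (auto dest: set_words)
    have v: "set v \<subseteq> insert b (S - U)" using U by (auto dest: set_tails)
    have "b \<notin> set u" using u U assms by auto
    moreover have "set u \<inter> set v = {}" using u v U assms by auto
    ultimately have "noncrossing (b # w)"
      using U by (simp add: noncrossing_split words_def tails_def)
    moreover have "count_list w i = (if i = b then Suc r else if i \<in> S then m i else 0)" for i
      using U assms by (auto simp: words_def tails_def)
    ultimately show "w \<in> tails m b (Suc r) S" by (simp add: tails_def)
  qed
  ultimately have "(\<Sum>w\<in>tails m b (Suc r) S. f w) = (\<Sum>p\<in>T. f (h p))"
    by (simp add: sum.reindex)
  also have "\<dots> = (\<Sum>U\<in>Pow S. \<Sum>(u, v)\<in>words m U \<times> tails m b r (S - U). f (u @ b # v))"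
    using assms unfolding T_def
    by (subst sum.Sigma) (auto simp: h_def intro!: sum.cong finite_words finite_tails
        intro: finite_subset)
  finally show ?thesis by (simp add: sum.cartesian_product)
qed

section \<open>Subset convolution\<close>

definition subset_conv :: "('a set \<Rightarrow> 'r::comm_semiring_1) \<Rightarrow> ('a set \<Rightarrow> 'r) \<Rightarrow> 'a set \<Rightarrow> 'r" where
  "subset_conv f k S = (\<Sum>U\<in>Pow S. f U * k (S - U))"

text \<open>The product of exponential generating functions, with letter sets kept in place of their
  sizes. Both sides sum over disjoint \<open>U\<close> and \<open>V\<close>, with \<open>k\<close>
  taking the rest.\<close>

lemma subset_conv_left_commute:
  "subset_conv f (subset_conv g k) = subset_conv g (subset_conv f k)"
proof
  fix S :: "'a set"
  show "subset_conv f (subset_conv g k) S = subset_conv g (subset_conv f k) S"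
  proof (cases "finite S")
    case False then show ?thesis by (simp add: subset_conv_def)
  next
    case True
    have P: "Pow (S - U) = {V \<in> Pow S. U \<inter> V = {}}" for U by auto
    have P': "Pow (S - U) = {V \<in> Pow S. V \<inter> U = {}}" for U by auto
    have "subset_conv f (subset_conv g k) S =
      (\<Sum>U\<in>Pow S. \<Sum>V\<in>{V \<in> Pow S. U \<inter> V = {}}. f U * g V * k (S - (U \<union> V)))"
      unfolding subset_conv_def sum_distrib_left P
      by (intro sum.cong refl) (simp add: mult.assoc Diff_eq Int_assoc)
    also have "\<dots> = (\<Sum>V\<in>Pow S. \<Sum>U\<in>{U \<in> Pow S. U \<inter> V = {}}. f U * g V * k (S - (U \<union> V)))"
      using True by (intro sum.swap_restrict) auto
    also have "\<dots> = subset_conv g (subset_conv f k) S"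
      unfolding subset_conv_def sum_distrib_left P'
      by (intro sum.cong refl) (simp add: mult.left_commute mult.assoc Diff_eq Int_ac)
    finally show ?thesis .
  qed
qed

lemma subset_conv_funpow_commute:
  "subset_conv f ((subset_conv g ^^ n) k) = (subset_conv g ^^ n) (subset_conv f k)"
  by (induction n arbitrary: k) (simp_all add: subset_conv_left_commute[of f g] funpow_swap1)

lemma subset_conv_funpow_funpow_commute:
  "(subset_conv f ^^ i) ((subset_conv g ^^ j) k) = (subset_conv g ^^ j) ((subset_conv f ^^ i) k)"
  by (induction i) (simp_all add: subset_conv_funpow_commute)

lemma subset_conv_cong:
  "(\<And>U. U \<subseteq> S \<Longrightarrow> f U = f' U) \<Longrightarrow> (\<And>U. U \<subseteq> S \<Longrightarrow> k U = k' U) \<Longrightarrow>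
    subset_conv f k S = subset_conv f' k' S"
  unfolding subset_conv_def by (intro sum.cong) auto

lemma subset_conv_funpow_cong:
  assumes "\<And>U. U \<subseteq> S \<Longrightarrow> f U = f' U" "\<And>U. U \<subseteq> S \<Longrightarrow> k U = k' U"
  shows "(subset_conv f ^^ n) k S = (subset_conv f' ^^ n) k' S"
  using assms
proof (induction n arbitrary: S)
  case (Suc n)
  have "(subset_conv f ^^ n) k U = (subset_conv f' ^^ n) k' U" if "U \<subseteq> S" for U
    using that Suc.prems by (intro Suc.IH) auto
  then show ?case using Suc.prems by (auto intro: subset_conv_cong)
qed simp

text \<open>Removing one letter is itself a convolution, and therefore commutes with all the
  others.\<close>

lemma subset_conv_singleton:
  "subset_conv (\<lambda>U. if U = {b} then 1 else 0) k S = (if b \<in> S \<and> finite S then k (S - {b}) else 0)"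
proof (cases "finite S")
  case True
  have "subset_conv (\<lambda>U. if U = {b} then 1 else 0) k S =
    (\<Sum>U\<in>Pow S. if U = {b} then k (S - {b}) else 0)"
    unfolding subset_conv_def by (intro sum.cong) auto
  then show ?thesis using True by simp
qed (simp add: subset_conv_def)

section \<open>Sums over words with prescribed top labels\<close>

definition gap_weight :: "('a \<Rightarrow> 'a list \<Rightarrow> 'r::comm_semiring_1) \<Rightarrow> 'a list \<Rightarrow> 'r" where
  "gap_weight g w = (\<Prod>(b, cs) \<leftarrow> gaps w. g b cs)"

lemma gap_weight_simps [simp]:
  "gap_weight g [] = 1"
  "b \<notin> set v \<Longrightarrow> gap_weight g (b # v) = gap_weight g v"
  "b \<notin> set u \<Longrightarrow> gap_weight g (b # u @ b # v) =
     g b (tops u) * gap_weight g u * gap_weight g (b # v)"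
  by (simp_all add: gap_weight_def mult.assoc)

definition block_sum :: "('a \<Rightarrow> 'a list \<Rightarrow> 'r::comm_semiring_1) \<Rightarrow> ('a \<Rightarrow> nat) \<Rightarrow> 'a \<Rightarrow> 'a set \<Rightarrow> 'r" where
  "block_sum g m b S = (\<Sum>w\<in>words m S. gap_weight g (b # w @ [b]))"

definition top_sum :: "('a \<Rightarrow> 'a list \<Rightarrow> 'r::comm_semiring_1) \<Rightarrow> ('a \<Rightarrow> nat) \<Rightarrow> 'a list \<Rightarrow> 'a set \<Rightarrow> 'r" where
  "top_sum g m cs S = (\<Sum>w\<in>words m S. if tops w = cs then gap_weight g w else 0)"

definition tail_sum ::
  "('a \<Rightarrow> 'a list \<Rightarrow> 'r::comm_semiring_1) \<Rightarrow> ('a \<Rightarrow> nat) \<Rightarrow> 'a \<Rightarrow> nat \<Rightarrow> 'a list \<Rightarrow> 'a set \<Rightarrow> 'r" where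
  "tail_sum g m b r cs S =
    (\<Sum>w\<in>tails m b r S. if tops (b # w) = b # cs then gap_weight g (b # w) else 0)"

lemma tail_sum_0:
  assumes "b \<notin> S" "\<forall>i. m i > 0"
  shows "tail_sum g m b 0 cs S = top_sum g m cs S"
  unfolding tail_sum_def top_sum_def tails_0[OF assms(1)]
  using assms by (intro sum.cong) (auto dest: set_words)

text \<open>Cutting off one gap of \<open>b\<close> does not affect the top labels, and its weight
  factors out.\<close>

lemma tail_sum_Suc:
  assumes "finite S" "b \<notin> S" "\<forall>i. m i > 0"
  shows "tail_sum g m b (Suc r) cs S = subset_conv (block_sum g m b) (tail_sum g m b r cs) S"
proof -
  have "tail_sum g m b (Suc r) cs S =
    (\<Sum>U\<in>Pow S. \<Sum>u\<in>words m U. \<Sum>v\<in>tails m b r (S - U).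
      gap_weight g (b # u @ [b]) * (if tops (b # v) = b # cs then gap_weight g (b # v) else 0))"
    unfolding tail_sum_def sum_tails_Suc[OF assms]
  proof (intro sum.cong refl)
    fix U u v assume "U \<in> Pow S" "u \<in> words m U"
    then have "b \<notin> set u" using assms by (auto dest: set_words)
    then show "(if tops (b # u @ b # v) = b # cs then gap_weight g (b # u @ b # v) else 0) =
      gap_weight g (b # u @ [b]) * (if tops (b # v) = b # cs then gap_weight g (b # v) else 0)"
      by simp
  qed
  then show ?thesis
    by (simp add: subset_conv_def block_sum_def tail_sum_def sum_product)
qed

lemma tail_sum_funpow:
  assumes "finite S" "b \<notin> S" "\<forall>i. m i > 0"
  shows "tail_sum g m b r cs S = (subset_conv (block_sum g m b) ^^ r) (top_sum g m cs) S"
  using assms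
proof (induction r arbitrary: S)
  case (Suc r)
  then show ?case
    unfolding tail_sum_Suc[OF Suc.prems] funpow.simps o_apply
    by (intro subset_conv_cong refl Suc.IH) (auto intro: finite_subset)
qed (simp add: tail_sum_0)

text \<open>Puts a block with label \<open>b\<close> in front: the letter \<open>b\<close> is taken
  out, each of its \<open>m b - 1\<close> gaps takes a subset of the letters, and \<open>k\<close>
  receives the rest.\<close>

definition block_op ::
  "('a \<Rightarrow> 'a list \<Rightarrow> 'r::comm_semiring_1) \<Rightarrow> ('a \<Rightarrow> nat) \<Rightarrow> 'a \<Rightarrow> ('a set \<Rightarrow> 'r) \<Rightarrow> 'a set \<Rightarrow> 'r" where
  "block_op g m b k = subset_conv (\<lambda>U. if U = {b} then 1 else 0)
     ((subset_conv (block_sum g m b) ^^ (m b - 1)) k)"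

lemma block_op_commute: "block_op g m b \<circ> block_op g m c = block_op g m c \<circ> block_op g m b"
proof
  fix k
  let ?D = "\<lambda>c. subset_conv (\<lambda>U. if U = {c} then 1 else 0)"
  let ?C = "\<lambda>c. subset_conv (block_sum g m c) ^^ (m c - 1)"
  have "?D b (?C b (?D c (?C c k))) = ?D b (?D c (?C b (?C c k)))"
    by (simp only: subset_conv_funpow_commute)
  also have "\<dots> = ?D c (?D b (?C c (?C b k)))"
    by (subst subset_conv_left_commute, subst subset_conv_funpow_funpow_commute) (rule refl)
  also have "\<dots> = ?D c (?C c (?D b (?C b k)))"
    by (simp only: subset_conv_funpow_commute)
  finally show "(block_op g m b \<circ> block_op g m c) k = (block_op g m c \<circ> block_op g m b) k"
    by (simp add: block_op_def)
qed

lemma block_op_eq: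
  "block_op g m b k S = (if b \<in> S \<and> finite S
     then (subset_conv (block_sum g m b) ^^ (m b - 1)) k (S - {b}) else 0)"
  unfolding block_op_def by (rule subset_conv_singleton)

lemma top_sum_Cons:
  assumes m: "\<forall>i. m i > 0"
  shows "top_sum g m (b # cs) = block_op g m b (top_sum g m cs)"
proof
  fix S
  show "top_sum g m (b # cs) S = block_op g m b (top_sum g m cs) S"
  proof (cases "b \<in> S \<and> finite S")
    case True
    have "top_sum g m (b # cs) S =
      (\<Sum>w\<in>(#) b ` tails m b (m b - 1) (S - {b}). if tops w = b # cs then gap_weight g w else 0)"
      unfolding top_sum_def
    \<comment> \<open>A word with first label \<open>b\<close> starts with the letter
      \<open>b\<close>, so all other words contribute 0.\<close>
    proof (intro sum.mono_neutral_right ballI)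
      show "(#) b ` tails m b (m b - 1) (S - {b}) \<subseteq> words m S"
        using words_eq_Cons[of b S m] True m by auto
      fix w assume w: "w \<in> words m S - (#) b ` tails m b (m b - 1) (S - {b})"
      have "tops w \<noteq> b # cs"
      proof
        assume t: "tops w = b # cs"
        then have "w \<noteq> []" by auto
        with t have "hd w = b" using hd_tops[of w] by simp
        then have "w = b # tl w" using \<open>w \<noteq> []\<close> by auto
        then show False using w words_eq_Cons[of b S m "tl w"] True m by (metis DiffE image_eqI)
      qed
      then show "(if tops w = b # cs then gap_weight g w else 0) = 0" by simp
    qed (use True in \<open>simp add: finite_words\<close>)
    also have "\<dots> = tail_sum g m b (m b - 1) cs (S - {b})"
      by (simp add: sum.reindex tail_sum_def)
    also have "\<dots> = (subset_conv (block_sum g m b) ^^ (m b - 1)) (top_sum g m cs) (S - {b})"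
      using True m by (intro tail_sum_funpow) auto
    finally show ?thesis using True by (simp add: block_op_eq)
  next
    case False
    have "tops w \<noteq> b # cs" if "w \<in> words m S" for w
    proof
      assume t: "tops w = b # cs"
      then have "w \<noteq> []" by auto
      with t have "b \<in> set w" using hd_tops[of w] hd_in_set[of w] by simp
      moreover have "set w = S" using set_words that m by metis
      ultimately show False using False by auto
    qed
    then have "top_sum g m (b # cs) S = 0" unfolding top_sum_def by (intro sum.neutral) auto
    then show ?thesis by (simp only: block_op_eq False if_False)
  qed
qed

text \<open>A word is built from its top labels by commuting operators, so their order cannot
  matter.\<close>

lemma top_sum_cong_mset:
  assumes "\<forall>i. m i > 0" "mset cs = mset ds"
  shows "top_sum g m cs = top_sum g m ds"
proof -
  have "top_sum g m cs = foldr (block_op g m) cs (top_sum g m [])" for cs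
    by (induction cs) (simp_all add: top_sum_Cons assms(1))
  moreover have "foldr (block_op g m) cs = fold (block_op g m) cs" for cs
    by (intro foldr_fold block_op_commute)
  moreover have "fold (block_op g m) cs = fold (block_op g m) ds"
    by (intro fold_multiset_equiv block_op_commute assms)
  ultimately show ?thesis by metis
qed

lemma block_sum_eq:
  assumes "finite S" "b \<notin> S" and m: "\<forall>i. m i > 0"
  shows "block_sum g m b S =
    (\<Sum>T\<in>Pow S. \<Sum>cs\<in>permutations_of_set T. g b cs * top_sum g m cs S)"
proof -
  have "(\<Sum>T\<in>Pow S. \<Sum>cs\<in>permutations_of_set T. g b cs * top_sum g m cs S) =
    (\<Sum>w\<in>words m S. \<Sum>T\<in>Pow S. \<Sum>cs\<in>permutations_of_set T.
      g b cs * (if tops w = cs then gap_weight g w else 0))"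
    unfolding top_sum_def sum_distrib_left by (subst (2) sum.swap, subst sum.swap) simp
  also have "\<dots> = block_sum g m b S"
    unfolding block_sum_def
  proof (intro sum.cong refl)
    fix w assume w: "w \<in> words m S"
    then have s: "set w = S" using m by (simp add: set_words)
    then have bw: "b \<notin> set w" using assms by simp
    have t: "distinct (tops w)" "set (tops w) \<subseteq> S"
      using w labels_gaps[of w] s by (auto simp: words_def)
    have "(\<Sum>T\<in>Pow S. \<Sum>cs\<in>permutations_of_set T.
        g b cs * (if tops w = cs then gap_weight g w else 0)) =
      (\<Sum>T\<in>Pow S. if T = set (tops w) then g b (tops w) * gap_weight g w else 0)"
    proof (intro sum.cong refl)
      fix T
      have "tops w \<in> permutations_of_set T \<longleftrightarrow> T = set (tops w)"
        using t by (auto simp: permutations_of_set_def)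
      then show "(\<Sum>cs\<in>permutations_of_set T. g b cs * (if tops w = cs then gap_weight g w else 0)) =
        (if T = set (tops w) then g b (tops w) * gap_weight g w else 0)"
        by (simp add: if_distrib sum.delta cong: if_cong)
    qed
    also have "\<dots> = gap_weight g (b # w @ [b])"
      using t assms(1) bw by simp
    finally show "(\<Sum>T\<in>Pow S. \<Sum>cs\<in>permutations_of_set T.
        g b cs * (if tops w = cs then gap_weight g w else 0)) = gap_weight g (b # w @ [b])" .
  qed
  finally show ?thesis by simp
qed

text \<open>Words are grouped by the set of labels in the outer gap. Nested gaps have fewer letters
  available, so the induction hypothesis exchanges their weights; what they contribute is the same
  for every order of the labels and factors out. This leaves the local sums over all orders, which
  agree by assumption.\<close>

lemma block_sum_exchange:
  assumes m: "\<forall>i. m i > 0"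
    and gh: "\<And>b T. finite T \<Longrightarrow> b \<notin> T \<Longrightarrow>
      (\<Sum>cs\<in>permutations_of_set T. g b cs) = (\<Sum>cs\<in>permutations_of_set T. h b cs)"
    and "finite S" "b \<notin> S"
  shows "block_sum g m b S = block_sum h m b S"
  using assms(3,4)
proof (induction S arbitrary: b rule: finite_psubset_induct)
  case (psubset S)
  \<comment> \<open>A gap inside the block of \<open>c\<close> draws its letters from
    \<open>V - {c}\<close>, a proper subset of \<open>S\<close>, so the induction hypothesis applies
    to it.\<close>
  have K: "top_sum g m cs V = top_sum h m cs V" if "V \<subseteq> S" for cs V
    using that
  proof (induction cs arbitrary: V)
    case Nil
    show ?case unfolding top_sum_def by (intro sum.cong) auto
  next
    case (Cons c cs)
    show ?case
    proof (cases "c \<in> V \<and> finite V")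
      case True
      have "(subset_conv (block_sum g m c) ^^ (m c - 1)) (top_sum g m cs) (V - {c}) =
        (subset_conv (block_sum h m c) ^^ (m c - 1)) (top_sum h m cs) (V - {c})"
        using True Cons by (intro subset_conv_funpow_cong psubset.IH Cons.IH) auto
      then show ?thesis by (simp add: top_sum_Cons m block_op_eq)
    qed (auto simp: top_sum_Cons m block_op_eq)
  qed
  have "block_sum g m b S =
    (\<Sum>T\<in>Pow S. \<Sum>cs\<in>permutations_of_set T. g b cs * top_sum g m cs S)"
    using psubset m by (intro block_sum_eq) auto
  also have "\<dots> = (\<Sum>T\<in>Pow S. \<Sum>cs\<in>permutations_of_set T. h b cs * top_sum h m cs S)"
  proof (rule sum.cong[OF refl])
    fix T assume T: "T \<in> Pow S"
    then have "finite T" "b \<notin> T" using psubset by (auto intro: finite_subset)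
    \<comment> \<open>One fixed order \<open>ds\<close> represents \<open>T\<close>, so that the
      factor \<open>top_sum\<close> can be taken out of the sum over orders.\<close>
    then obtain ds where ds: "ds \<in> permutations_of_set T" using permutations_of_set_empty_iff by blast
    have t: "top_sum g m cs = top_sum g m ds" if "cs \<in> permutations_of_set T" for cs g
      using that ds m by (intro top_sum_cong_mset)
        (auto simp: permutations_of_set_def set_eq_iff_mset_eq_distinct)
    have "(\<Sum>cs\<in>permutations_of_set T. g b cs * top_sum g m cs S) =
      (\<Sum>cs\<in>permutations_of_set T. g b cs) * top_sum g m ds S"
      unfolding sum_distrib_right by (intro sum.cong refl) (simp add: t)
    also have "\<dots> = (\<Sum>cs\<in>permutations_of_set T. h b cs) * top_sum h m ds S"
      using gh[OF \<open>finite T\<close> \<open>b \<notin> T\<close>] K[of S] by simp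
    also have "\<dots> = (\<Sum>cs\<in>permutations_of_set T. h b cs * top_sum h m cs S)"
      unfolding sum_distrib_right by (intro sum.cong refl) (simp add: t)
    finally show "(\<Sum>cs\<in>permutations_of_set T. g b cs * top_sum g m cs S) =
      (\<Sum>cs\<in>permutations_of_set T. h b cs * top_sum h m cs S)" .
  qed
  also have "\<dots> = block_sum h m b S"
    using psubset m by (intro block_sum_eq[symmetric]) auto
  finally show ?case .
qed

section \<open>The expansion\<close>

definition gamma_gap_weight :: "'r::comm_semiring_1 \<Rightarrow> 'r \<Rightarrow> 'r \<Rightarrow> nat \<Rightarrow> nat list \<Rightarrow> 'r" where
  "gamma_gap_weight x y z b cs = (if cs = [] then z else gamma_weight x y cs)"

text \<open>Padding makes the whole word the content of a gap of the letter 0, so the exchange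
  applies with \<open>b = 0\<close>.\<close>

lemma sum_words_des_asc_plat:
  fixes x y z :: "'r::comm_semiring_1"
  assumes "\<forall>i. m i > 0" "finite S" "0 \<notin> S"
  shows "(\<Sum>\<pi>\<in>words m S. x ^ des \<pi> * y ^ asc \<pi> * z ^ plat \<pi>) =
    (\<Sum>\<pi>\<in>words m S. gap_weight (gamma_gap_weight x y z) (padded \<pi>))"
proof -
  let ?g = "\<lambda>b cs. path_weight x y z (b # cs @ [b])"
  have "(\<Sum>\<pi>\<in>words m S. x ^ des \<pi> * y ^ asc \<pi> * z ^ plat \<pi>) = block_sum ?g m 0 S"
    unfolding block_sum_def
  proof (intro sum.cong refl)
    fix \<pi> assume "\<pi> \<in> words m S"
    then have "0 \<notin> set \<pi>" using assms by (auto dest: set_words)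
    from path_weight_padded_gaps[OF this, of x y z]
    show "x ^ des \<pi> * y ^ asc \<pi> * z ^ plat \<pi> = gap_weight ?g (0 # \<pi> @ [0])"
      by (simp only: path_weight_padded gap_weight_def padded_def[symmetric])
  qed
  also have "\<dots> = block_sum (gamma_gap_weight x y z) m 0 S"
  proof (rule block_sum_exchange[OF assms(1) _ assms(2,3)])
    fix b :: nat and T :: "nat set" assume T: "finite T" "b \<notin> T"
    show "(\<Sum>cs\<in>permutations_of_set T. ?g b cs) =
      (\<Sum>cs\<in>permutations_of_set T. gamma_gap_weight x y z b cs)"
    proof (cases "T = {}")
      case True then show ?thesis by (simp add: gamma_gap_weight_def step_weight_def)
    next
      case False
      have "(\<Sum>cs\<in>permutations_of_set T. gamma_gap_weight x y z b cs) =
        (\<Sum>cs\<in>permutations_of_set T. gamma_weight x y cs)"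
        using False by (intro sum.cong) (auto simp: gamma_gap_weight_def dest: permutations_of_setD)
      then show ?thesis using sum_cyclic_path_weight[OF T(1) False T(2)] by simp
    qed
  qed
  finally show ?thesis by (simp add: block_sum_def padded_def)
qed

text \<open>For the padded word, \<open>E\<close>, \<open>C\<close> and \<open>L\<close> are the
  numbers of plateaus, of sibling descents, and \<open>M + 1\<close>. A gap with
  \<open>k > 0\<close> labels has degree \<open>k + 1\<close> in \<open>x\<close> and
  \<open>y\<close>; an empty gap counts 1 in \<open>L\<close> as well, but gives only
  \<open>z\<close>, so \<open>E\<close> is subtracted.\<close>

lemma prod_list_gamma_gap_weight:
  fixes x y z :: "'r::comm_semiring_1" and gs :: "(nat \<times> nat list) list"
  defines "E \<equiv> (\<Sum>(b, cs) \<leftarrow> gs. if cs = [] then 1 else 0)"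
    and "C \<equiv> (\<Sum>(b, cs) \<leftarrow> gs. card {p. sibling_descent_in cs p})"
    and "L \<equiv> (\<Sum>(b, cs) \<leftarrow> gs. Suc (length cs))"
  assumes "\<And>b cs. (b, cs) \<in> set gs \<Longrightarrow> distinct cs \<and> \<not> double_descent_in cs"
  shows "E + 2 * C \<le> L \<and> (\<Prod>(b, cs) \<leftarrow> gs. gamma_gap_weight x y z b cs) =
    z ^ E * (x * y) ^ C * (x + y) ^ (L - E - 2 * C)"
  using assms(4) unfolding E_def C_def L_def
proof (induction gs)
  case (Cons bc gs)
  obtain b cs where bc: "bc = (b, cs)" by force
  define E C L where "E = (\<Sum>(b, cs) \<leftarrow> gs. if cs = [] then 1 else (0::nat))"
    and "C = (\<Sum>(b, cs) \<leftarrow> gs. card {p. sibling_descent_in cs p})"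
    and "L = (\<Sum>(b, cs) \<leftarrow> gs. Suc (length cs))"
  have IH: "E + 2 * C \<le> L" "(\<Prod>(b, cs) \<leftarrow> gs. gamma_gap_weight x y z b cs) =
      z ^ E * (x * y) ^ C * (x + y) ^ (L - E - 2 * C)"
  proof -
    have "E + 2 * C \<le> L \<and> (\<Prod>(b, cs) \<leftarrow> gs. gamma_gap_weight x y z b cs) =
        z ^ E * (x * y) ^ C * (x + y) ^ (L - E - 2 * C)"
      unfolding E_def C_def L_def
      using Cons.prems by (intro Cons.IH) (meson list.set_intros(2))
    then show "E + 2 * C \<le> L" "(\<Prod>(b, cs) \<leftarrow> gs. gamma_gap_weight x y z b cs) =
        z ^ E * (x * y) ^ C * (x + y) ^ (L - E - 2 * C)" by blast+
  qed
  show ?case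
  proof (cases "cs = []")
    case True
    have "Collect (sibling_descent_in []) = {}" by auto
    then have "card (Collect (sibling_descent_in [])) = 0" by (simp only: card.empty)
    then show ?thesis
      using IH True unfolding bc
      by (simp add: gamma_gap_weight_def mult.assoc flip: E_def C_def L_def)
  next
    case False
    define k where "k = card {p. sibling_descent_in cs p}"
    have k: "2 * k \<le> Suc (length cs)"
      "gamma_weight x y cs = (x * y) ^ k * (x + y) ^ (Suc (length cs) - 2 * k)"
      using gamma_weight_eq[of cs x y] False Cons.prems[of b cs] unfolding k_def bc by simp_all
    \<comment> \<open>The subtractions are truncated; that the exponents add up rests on both
      inequalities.\<close>
    have e: "Suc (length cs) + L - E - 2 * (k + C) = (Suc (length cs) - 2 * k) + (L - E - 2 * C)"
    proof -
      obtain d where d: "Suc (length cs) = 2 * k + d" using k(1) le_Suc_ex by blast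
      obtain d' where d': "L = E + 2 * C + d'" using IH(1) le_Suc_ex by blast
      show ?thesis unfolding d d' by simp
    qed
    have "(\<Prod>(b, cs) \<leftarrow> bc # gs. gamma_gap_weight x y z b cs) =
      (x * y) ^ k * (x + y) ^ (Suc (length cs) - 2 * k) *
      (z ^ E * (x * y) ^ C * (x + y) ^ (L - E - 2 * C))"
    proof -
      have "gamma_gap_weight x y z b cs = (x * y) ^ k * (x + y) ^ (Suc (length cs) - 2 * k)"
        using False by (simp add: gamma_gap_weight_def k(2))
      then show ?thesis
        unfolding bc by (simp only: list.map prod_list.Cons prod.case IH(2))
    qed
    also have "\<dots> = z ^ E * (x * y) ^ (k + C) * (x + y) ^ (Suc (length cs) + L - E - 2 * (k + C))"
      unfolding e power_add by (simp only: ac_simps)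
    finally show ?thesis
      using False k(1) IH(1) unfolding bc by (simp flip: E_def C_def L_def k_def)
  qed
qed simp

lemma plat_eq_gaps:
  assumes "noncrossing \<pi>" "0 \<notin> set \<pi>"
  shows "plat \<pi> = (\<Sum>(b, cs) \<leftarrow> gaps (padded \<pi>). if cs = [] then 1 else 0)"
proof -
  let ?P = "\<lambda>(p :: nat, q). p = q"
  have "plat \<pi> = size (filter_mset ?P (mset (pairs (padded \<pi>))))"
    unfolding statistics_pairs by (simp only: size_mset flip: mset_filter)
  also have "\<dots> = length (filter ?P (concat (map (\<lambda>(b, cs). pairs (b # cs @ [b])) (gaps (padded \<pi>)))))"
    unfolding mset_pairs_padded[OF assms(2)] by (simp only: size_mset flip: mset_filter)
  also have "\<dots> = (\<Sum>(b, cs) \<leftarrow> gaps (padded \<pi>). length (filter ?P (pairs (b # cs @ [b]))))"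
    by (simp add: filter_concat length_concat o_def case_prod_unfold)
  also have "\<dots> = (\<Sum>(b, cs) \<leftarrow> gaps (padded \<pi>). if cs = [] then 1 else 0)"
  proof (intro arg_cong[of _ _ sum_list] map_cong refl, clarify)
    fix b cs assume "(b, cs) \<in> set (gaps (padded \<pi>))"
    then show "length (filter ?P (pairs (b # cs @ [b]))) = (if cs = [] then 1 else 0)"
      by (intro pairs_closed_distinct labels_gaps_padded(2)[OF assms])
  qed
  finally show ?thesis .
qed

lemma sd_eq_gaps:
  assumes "noncrossing \<pi>" "0 \<notin> set \<pi>"
  shows "sd \<pi> = (\<Sum>(b, cs) \<leftarrow> gaps (padded \<pi>). card {p. sibling_descent_in cs p})"
proof -
  have "sd \<pi> = card {p. \<exists>cs \<in> set (map snd (gaps (padded \<pi>))). sibling_descent_in cs p}"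
    unfolding sd_eq_card_label descent_label_iff[OF assms] by simp
  also have "\<dots> = (\<Sum>cs \<leftarrow> map snd (gaps (padded \<pi>)). card {p. sibling_descent_in cs p})"
    by (rule card_sibling_descent_in_concat[OF labels_gaps_padded(1)[OF assms]])
  finally show ?thesis by (simp add: case_prod_unfold o_def)
qed

lemma length_eq_gaps_padded:
  assumes "0 \<notin> set \<pi>"
  shows "Suc (length \<pi>) = (\<Sum>(b, cs) \<leftarrow> gaps (padded \<pi>). Suc (length cs))"
  using length_eq_gaps[of "padded \<pi>"] assms by (simp add: padded_def)

lemma gap_weight_gamma_gap_weight:
  fixes x y z :: "'r::comm_semiring_1"
  assumes "noncrossing \<pi>" "0 \<notin> set \<pi>"
  shows "gap_weight (gamma_gap_weight x y z) (padded \<pi>) =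
    (if dsd \<pi> = 0 then z ^ plat \<pi> * (x * y) ^ sd \<pi> * (x + y) ^ (Suc (length \<pi>) - plat \<pi> - 2 * sd \<pi>)
     else 0)"
    and "dsd \<pi> = 0 \<Longrightarrow> plat \<pi> + 2 * sd \<pi> \<le> Suc (length \<pi>)"
proof -
  have *: "plat \<pi> + 2 * sd \<pi> \<le> Suc (length \<pi>) \<and> gap_weight (gamma_gap_weight x y z) (padded \<pi>) =
    z ^ plat \<pi> * (x * y) ^ sd \<pi> * (x + y) ^ (Suc (length \<pi>) - plat \<pi> - 2 * sd \<pi>)" if "dsd \<pi> = 0" for x y z :: 'r
    unfolding gap_weight_def plat_eq_gaps[OF assms] sd_eq_gaps[OF assms] length_eq_gaps_padded[OF assms(2)]
  proof (rule prod_list_gamma_gap_weight)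
    fix b cs assume bc: "(b, cs) \<in> set (gaps (padded \<pi>))"
    then have "cs \<in> snd ` set (gaps (padded \<pi>))" by force
    then have "\<not> double_descent_in cs"
      using that unfolding dsd_eq_0_iff_gaps[OF assms] by (rule bspec[rotated])
    then show "distinct cs \<and> \<not> double_descent_in cs"
      using labels_gaps_padded(2)[OF assms bc] by simp
  qed
  then show "dsd \<pi> = 0 \<Longrightarrow> plat \<pi> + 2 * sd \<pi> \<le> Suc (length \<pi>)" by blast
  show "gap_weight (gamma_gap_weight x y z) (padded \<pi>) =
    (if dsd \<pi> = 0 then z ^ plat \<pi> * (x * y) ^ sd \<pi> * (x + y) ^ (Suc (length \<pi>) - plat \<pi> - 2 * sd \<pi>)
     else 0)"
  proof (cases "dsd \<pi> = 0")
    case True then show ?thesis using * by simp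
  next
    case False
    have zero: "0 \<in> set xs \<Longrightarrow> prod_list xs = 0" for xs :: "'r list"
      by (induction xs) auto
    from False obtain b cs where bc: "(b, cs) \<in> set (gaps (padded \<pi>))" "double_descent_in cs"
      using dsd_eq_0_iff_gaps[OF assms] by force
    then have "cs \<noteq> []" by auto
    moreover have "distinct cs" using labels_gaps_padded(2)[OF assms bc(1)] by simp
    ultimately have "gamma_gap_weight x y z b cs = 0"
      using gamma_weight_eq[of cs x y] bc(2) by (simp add: gamma_gap_weight_def)
    then have "0 \<in> set (map (\<lambda>(b, cs). gamma_gap_weight x y z b cs) (gaps (padded \<pi>)))"
      using bc(1) by force
    then have "gap_weight (gamma_gap_weight x y z) (padded \<pi>) = 0"
      unfolding gap_weight_def by (rule zero)
    then show ?thesis using False by simp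
  qed
qed

text \<open>These bounds give the summation ranges. The last outermost block stands before the final
  0 and always yields a sibling descent. A letter with \<open>k\<close> copies has
  \<open>k - 1\<close> gaps, each with at most one plateau, while the gap of 0 is nonempty and has
  none.\<close>

lemma plat_sd_bounds:
  assumes "noncrossing \<pi>" "0 \<notin> set \<pi>" "\<pi> \<noteq> []"
  shows "1 \<le> sd \<pi>" "plat \<pi> + card (set \<pi>) \<le> length \<pi>"
proof -
  have g: "gaps (padded \<pi>) = (0, tops \<pi>) # gaps \<pi>"
    using assms(2) by (simp add: padded_def)
  have "last (tops \<pi>) \<in> {p. sibling_descent_in (tops \<pi>) p}"
    using assms(3) by (simp add: sibling_descent_in_def)
  then have "card {p. sibling_descent_in (tops \<pi>) p} \<noteq> 0"
    using finite_sibling_descent_in[of "tops \<pi>"] by auto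
  then show "1 \<le> sd \<pi>" unfolding sd_eq_gaps[OF assms(1,2)] g by simp
  have "plat \<pi> = (\<Sum>(b, cs) \<leftarrow> gaps \<pi>. if cs = [] then 1 else 0)"
    unfolding plat_eq_gaps[OF assms(1,2)] g using assms(3) by simp
  also have "\<dots> \<le> (\<Sum>(b, cs) \<leftarrow> gaps \<pi>. 1)"
    by (rule sum_list_mono) auto
  finally have p: "plat \<pi> \<le> length (gaps \<pi>)" by (simp add: case_prod_unfold sum_list_triv)
  have "card (set \<pi>) = length (tops \<pi> @ concat (map snd (gaps \<pi>)))"
    using labels_gaps[OF assms(1)] by (metis distinct_card)
  also have "\<dots> = length (tops \<pi>) + (\<Sum>(b, cs) \<leftarrow> gaps \<pi>. length cs)"
    by (simp add: length_concat case_prod_unfold o_def)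
  finally have "card (set \<pi>) + length (gaps \<pi>) = length \<pi>"
    unfolding length_eq_gaps[of \<pi>]
    by (simp add: case_prod_unfold sum_list_Suc)
  then show "plat \<pi> + card (set \<pi>) \<le> length \<pi>" using p by simp
qed

lemma quasi_stirling_eq_words:
  assumes "\<And>i. i \<in> {1..n} \<Longrightarrow> m' i = m i"
  shows "quasi_stirling (exp_mset n m) = words m' {1..n}"
proof -
  have "count (exp_mset n m) i = (if i \<in> {1..n} then m' i else 0)" for i
    using assms by (simp add: exp_mset_def count_sum)
  then have "mset w = exp_mset n m \<longleftrightarrow> (\<forall>i. count_list w i = (if i \<in> {1..n} then m' i else 0))" for w
    by (simp add: multiset_eq_iff count_mset)
  then show ?thesis
    by (auto simp: quasi_stirling_def words_def noncrossing_def permutations_of_multiset_def)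
qed

lemma coeff_z3_power_times: "coeff (z3 ^ i * [:c:]) k = (if k = i then c else 0)"
proof -
  have "z3 ^ i * [:c:] = monom c i" by (simp add: monom_altdef z3_def)
  then show ?thesis by simp
qed

lemma const_poly_sum: "(\<Sum>i\<in>A. [:f i:]) = [:\<Sum>i\<in>A. f i:]"
  by (induction A rule: infinite_finite_induct) simp_all

text \<open>Makes each summand a constant in \<open>z\<close>, so that coefficients can be read
  off.\<close>

lemma of_nat_power_const_poly:
  "of_nat c * (x3 * y3) ^ j * (x3 + y3) ^ k = [:of_nat c * (x2 * y2) ^ j * (x2 + y2) ^ k:]"
proof -
  have *: "[:a:] * [:b:] = [:a * b:]" "[:a:] + [:b:] = [:a + b:]" for a b :: "int poly poly"
    by simp_all
  have "of_nat c = ([:of_nat c:] :: int poly poly poly)" by (rule of_nat_poly)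
  then show ?thesis by (simp only: x3_def y3_def * poly_const_pow)
qed

theorem theorem1p3:
  fixes n M :: nat and m :: "nat \<Rightarrow> nat" and \<M> :: "nat multiset"
  assumes "n \<ge> 1"
    and "\<And>i. 1 \<le> i \<Longrightarrow> i \<le> n \<Longrightarrow> m i \<ge> 1"
    and "\<M> = exp_mset n m"
    and "M = (\<Sum>i = 1..n. m i)"
  shows "quasi_stirling_poly \<M> =
           (\<Sum>i = 0..M - n. z3 ^ i *
             (\<Sum>j = 1..(M + 1 - i) div 2.
               of_nat (gamma_coeff \<M> i j) * (x3 * y3) ^ j * (x3 + y3) ^ (M + 1 - i - 2 * j)))
         \<and> partial_gamma_positive (quasi_stirling_poly \<M>)"
proof
  \<comment> \<open>The lemmas on \<open>words\<close> want positive multiplicities for all letters;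
    the value 1 outside the range leaves the set of words unchanged.\<close>
  define m' where "m' i = (if i \<in> {1..n} then m i else 1)" for i
  have m': "\<forall>i. m' i > 0" using assms(2) by (fastforce simp: m'_def)
  define Q where "Q = quasi_stirling \<M>"
  have Q: "Q = words m' {1..n}"
    unfolding Q_def assms(3) by (rule quasi_stirling_eq_words) (simp add: m'_def)
  have finite: "finite Q" by (simp add: Q finite_words)
  have word: "noncrossing \<pi>" "set \<pi> = {1..n}" "0 \<notin> set \<pi>" "\<pi> \<noteq> []" "length \<pi> = M"
    if "\<pi> \<in> Q" for \<pi>
  proof -
    show s: "set \<pi> = {1..n}" using that m' unfolding Q by (rule set_words)
    show "noncrossing \<pi>" using that by (simp add: Q words_def)
    show "0 \<notin> set \<pi>" "\<pi> \<noteq> []" using s assms(1) by auto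
    have "length \<pi> = (\<Sum>i\<in>{1..n}. count_list \<pi> i)" by (rule sum_count_set[symmetric]) (simp_all add: s)
    also have "\<dots> = M" unfolding assms(4) using that by (intro sum.cong) (auto simp: Q words_def m'_def)
    finally show "length \<pi> = M" .
  qed
  define Q0 where "Q0 = {\<pi> \<in> Q. dsd \<pi> = 0}"
  define F where "F i j = z3 ^ i * ((x3 * y3) ^ j * (x3 + y3) ^ (M + 1 - i - 2 * j))" for i j
  define T where "T = (SIGMA i:{0..M - n}. {1..(M + 1 - i) div 2})"
  have "quasi_stirling_poly \<M> =
    (\<Sum>\<pi>\<in>Q. gap_weight (gamma_gap_weight x3 y3 z3) (padded \<pi>))"
    unfolding quasi_stirling_poly_def Q_def[symmetric] unfolding Q
    by (rule sum_words_des_asc_plat[OF m']) auto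
  also have "\<dots> = (\<Sum>\<pi>\<in>Q. if dsd \<pi> = 0 then F (plat \<pi>) (sd \<pi>) else 0)"
    by (intro sum.cong refl) (simp add: gap_weight_gamma_gap_weight(1) word F_def mult.assoc)
  also have "\<dots> = (\<Sum>\<pi>\<in>Q0. F (plat \<pi>) (sd \<pi>))"
    unfolding Q0_def using finite by (simp add: sum.inter_filter)
  also have "\<dots> = (\<Sum>t\<in>T. \<Sum>\<pi>\<in>{\<pi> \<in> Q0. (plat \<pi>, sd \<pi>) = t}. F (plat \<pi>) (sd \<pi>))"
  \<comment> \<open>Grouping by the two statistics loses nothing because every word of
    \<open>Q0\<close> falls into \<open>T\<close>. The upper limit for \<open>j\<close> is the
    nonnegativity of the exponent of \<open>x + y\<close>.\<close>
  proof (rule sum.group[symmetric])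
    show "(\<lambda>\<pi>. (plat \<pi>, sd \<pi>)) ` Q0 \<subseteq> T"
    proof safe
      fix \<pi> assume "\<pi> \<in> Q0"
      then have \<pi>: "\<pi> \<in> Q" "dsd \<pi> = 0" by (auto simp: Q0_def)
      note w = word[OF \<pi>(1)]
      have "plat \<pi> + n \<le> M" "1 \<le> sd \<pi>"
        using plat_sd_bounds[OF w(1,3,4)] w(2,5) by simp_all
      moreover have "plat \<pi> + 2 * sd \<pi> \<le> Suc M"
        using gap_weight_gamma_gap_weight(2)[OF w(1,3) \<pi>(2)] w(5) by simp
      ultimately show "(plat \<pi>, sd \<pi>) \<in> T" by (auto simp: T_def)
    qed
  qed (use finite in \<open>auto simp: Q0_def T_def\<close>)
  also have "\<dots> = (\<Sum>(i, j)\<in>T. of_nat (gamma_coeff \<M> i j) * F i j)"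
  proof (intro sum.cong refl, clarify)
    fix i j
    have "gamma_coeff \<M> i j = card {\<pi> \<in> Q0. (plat \<pi>, sd \<pi>) = (i, j)}"
      unfolding gamma_coeff_def Q0_def Q_def by (rule arg_cong[of _ _ card]) auto
    then show "(\<Sum>\<pi>\<in>{\<pi> \<in> Q0. (plat \<pi>, sd \<pi>) = (i, j)}. F (plat \<pi>) (sd \<pi>)) =
      of_nat (gamma_coeff \<M> i j) * F i j"
      by simp
  qed
  also have "\<dots> = (\<Sum>i = 0..M - n. \<Sum>j = 1..(M + 1 - i) div 2. of_nat (gamma_coeff \<M> i j) * F i j)"
    unfolding T_def by (rule sum.Sigma[symmetric]) auto
  also have "\<dots> = (\<Sum>i = 0..M - n. z3 ^ i * (\<Sum>j = 1..(M + 1 - i) div 2.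
      of_nat (gamma_coeff \<M> i j) * (x3 * y3) ^ j * (x3 + y3) ^ (M + 1 - i - 2 * j)))"
    unfolding F_def sum_distrib_left by (intro sum.cong refl) (simp only: ac_simps)
  finally show expansion: "quasi_stirling_poly \<M> = \<dots>" .
  show "partial_gamma_positive (quasi_stirling_poly \<M>)"
    unfolding partial_gamma_positive_def
  proof
    fix k
    define p where "p i = (\<Sum>j = 1..(M + 1 - i) div 2.
      of_nat (gamma_coeff \<M> i j) * (x2 * y2) ^ j * (x2 + y2) ^ (M + 1 - i - 2 * j))" for i
    have "quasi_stirling_poly \<M> = (\<Sum>i = 0..M - n. z3 ^ i * [:p i:])"
      unfolding expansion p_def of_nat_power_const_poly const_poly_sum ..
    then have c: "coeff (quasi_stirling_poly \<M>) k = (if k \<le> M - n then p k else 0)"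
      by (simp only: coeff_sum coeff_z3_power_times) simp
    \<comment> \<open>The sum in \<open>gamma_positive\<close> starts at \<open>j = 0\<close>, where
      the expansion has no term, and beyond \<open>M - n\<close> the coefficient of \<open>z\<close>
      vanishes; both are covered by the value 0.\<close>
    define \<gamma> where "\<gamma> j = (if k \<le> M - n \<and> 1 \<le> j then int (gamma_coeff \<M> k j) else 0)" for j
    have "(\<Sum>j = 0..(M + 1 - k) div 2. of_int (\<gamma> j) * (x2 * y2) ^ j * (x2 + y2) ^ (M + 1 - k - 2 * j)) =
      (\<Sum>j = 1..(M + 1 - k) div 2. of_int (\<gamma> j) * (x2 * y2) ^ j * (x2 + y2) ^ (M + 1 - k - 2 * j))"
      by (rule sum.mono_neutral_right) (auto simp: \<gamma>_def)
    also have "\<dots> = coeff (quasi_stirling_poly \<M>) k"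
      unfolding c p_def by (simp add: \<gamma>_def)
    finally show "gamma_positive (coeff (quasi_stirling_poly \<M>) k)"
      unfolding gamma_positive_def
      by (intro exI[of _ "M + 1 - k"] exI[of _ \<gamma>]) (simp add: \<gamma>_def)
  qed
qed

end
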